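(* Let $m_1\in\mathbb{N}$ be odd and let $m_2\in\mathbb{N}$ be such that $\frac{m_2}{2}$ is an even natural number. Let $\Omega_1$ be a Tricomi domain (of the type described in the context, with boundary $\partial\Omega_1=\sigma_1\cup AC\cup BC$) for the operator $\mathcal{O}(u)=-y^{m_1}u_{xx}-x^{m_2}u_{yy}$, whose boundary is piecewise $C^1$ with exterior unit normal vector $\eta$. Let $f\in C^0(\mathbb{R})$ and let $F$ be the primitive of $f$ with $F(0)=0$. If $u\in C^2(\overline{\Omega_1})$ is a solution of $$\mathcal{O}(u)=f(u)\ \text{ in }\Omega_1,\qquad u=0\ \text{ on } AC\cup\sigma_1\subseteq\partial\Omega_1,$$ then $$(m_1+m_2+4)\int_{\Omega_1} F(u)-\frac{m_1+m_2+m_1m_2}{2}\int_{\Omega_1} uf(u)=\frac{1}{2}\left[\int_{BC\cup\sigma_1}\omega_1+\int_{BC}\omega_2\right],$$ where $$\omega_1=\Bigl[2\,Du\,(-y^{m_1}u_x,-x^{m_2}u_y)+(y^{m_1}u_x^2+x^{m_2}u_y^2)\,(-(m_1+2)x,-(m_2+2)y)\Bigr]\cdot\eta,$$ $$\omega_2=\Bigl[-2F(u)\,(-(m_1+2)x,-(m_2+2)y)-(m_1+m_2+m_1m_2)\,u\,(-y^{m_1}u_x,-x^{m_2}u_y)\Bigr]\cdot\eta,$$ and $D$ is the vector field $D=-(m_1+2)x\,\partial_x-(m_2+2)y\,\partial_y$, i.e. $Du=-(m_1+2)x\,u_x-(m_2+2)y\,u_y$.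
   Context: Here $\mathbb{N}=\{0,1,2,\dots\}$. Integrals over subsets of the boundary are with respect to arc length; integrals over the domain are with respect to Lebesgue measure $dx\,dy$. Tricomi domain $\Omega_1$ for $\mathcal{O}$ (with $m_1$ odd and $m_2/2$ even): fix $x_0<0$ and put $A=(2x_0,0)$, $B=(0,0)$. $\Omega_1\subset\mathbb{R}^2$ is an open, bounded, simply connected set with piecewise $C^1$ boundary $\partial\Omega_1=\sigma_1\cup AC\cup BC$, where $\sigma_1$ is an arc lying in $\{(x,y):y>0\}$ apart from its endpoints $A$ and $B$ on the $x$-axis, and $AC$, $BC$ are the characteristic curves of $\mathcal{O}$ (i.e. curves satisfying $-y^{m_1}(dy)^2-x^{m_2}(dx)^2=0$) in $\{(x,y): x\le 0,\ y\le 0\}$ passing through $A$ and $B$ respectively and meeting at the point $C$. Explicitly, $$AC=\left\{(x,y):\ x\le0,\ y_C\le y\le 0,\ \tfrac{2}{m_1+2}(-y)^{\frac{m_1+2}{2}}=\tfrac{2}{m_2+2}\left[x^{\frac{m_2+2}{2}}-(2x_0)^{\frac{m_2+2}{2}}\right]\right\},$$ $$BC=\left\{(x,y):\ x\le0,\ y_C\le y\le 0,\ \tfrac{2}{m_1+2}(-y)^{\frac{m_1+2}{2}}=-\tfrac{2}{m_2+2}x^{\frac{m_2+2}{2}}\right\},$$ where $\frac{m_2+2}{2}$ is an odd integer, and $C=\left((\tfrac12)^{\frac{2}{m_2+2}}(2x_0),\,y_C\right)$ with $y_C=-\left[-\tfrac12\,\tfrac{m_1+2}{m_2+2}\,(2x_0)^{\frac{m_2+2}{2}}\right]^{\frac{2}{m_1+2}}$.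 *)

theory Defs
  imports "HOL-Analysis.Analysis"
begin

section \<open>Functions of class \<open>C\<^sup>2\<close> up to the boundary\<close>

text \<open>On the open set \<open>\<Omega>\<close> these are the classical partial derivatives; at the remaining points
  of the closure they are the limits of the classical derivatives from inside \<open>\<Omega>\<close>.\<close>

definition partial_x :: "(real \<times> real) set \<Rightarrow> (real \<times> real \<Rightarrow> real) \<Rightarrow> real \<times> real \<Rightarrow> real" where
  "partial_x \<Omega> u p =
     (if p \<in> \<Omega> then deriv (\<lambda>s. u (s, snd p)) (fst p)
      else Lim (at p within \<Omega>) (\<lambda>q. deriv (\<lambda>s. u (s, snd q)) (fst q)))"

definition partial_y :: "(real \<times> real) set \<Rightarrow> (real \<times> real \<Rightarrow> real) \<Rightarrow> real \<times> real \<Rightarrow> real" where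
  "partial_y \<Omega> u p =
     (if p \<in> \<Omega> then deriv (\<lambda>s. u (fst p, s)) (snd p)
      else Lim (at p within \<Omega>) (\<lambda>q. deriv (\<lambda>s. u (fst q, s)) (snd q)))"

text \<open>Continuity of \<open>partial_x \<Omega> u\<close> on the closure says exactly that the classical derivative on
  \<open>\<Omega>\<close> is continuous and extends continuously to the closure; no extension of \<open>u\<close> beyond the closure
  is required.\<close>

definition C1_closure :: "(real \<times> real) set \<Rightarrow> (real \<times> real \<Rightarrow> real) \<Rightarrow> bool" where
  "C1_closure \<Omega> u \<longleftrightarrow>
     continuous_on (closure \<Omega>) u \<and>
     (\<forall>(x, y)\<in>\<Omega>. (\<lambda>s. u (s, y)) differentiable (at x) \<and> (\<lambda>s. u (x, s)) differentiable (at y)) \<and>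
     continuous_on (closure \<Omega>) (partial_x \<Omega> u) \<and>
     continuous_on (closure \<Omega>) (partial_y \<Omega> u)"

definition C2_closure :: "(real \<times> real) set \<Rightarrow> (real \<times> real \<Rightarrow> real) \<Rightarrow> bool" where
  "C2_closure \<Omega> u \<longleftrightarrow>
     C1_closure \<Omega> u \<and> C1_closure \<Omega> (partial_x \<Omega> u) \<and> C1_closure \<Omega> (partial_y \<Omega> u)"


section \<open>Piecewise \<open>C\<^sup>1\<close> boundaries, exterior normal and arc length\<close>

text \<open>Derivatives at \<open>a\<close> and \<open>b\<close> are one-sided, so tangents have nonzero limits at corners. The library's
  \<open>piecewise_C1_differentiable_on\<close> is too weak here: it bounds neither the derivative near a
  breakpoint nor the length of the curve.\<close>

definition C1_regular_on :: "(real \<Rightarrow> real \<times> real) \<Rightarrow> real \<Rightarrow> real \<Rightarrow> bool" where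
  "C1_regular_on \<gamma> a b \<longleftrightarrow>
     (\<exists>\<gamma>'. continuous_on {a..b} \<gamma>' \<and>
       (\<forall>t\<in>{a..b}. (\<gamma> has_vector_derivative \<gamma>' t) (at t within {a..b}) \<and> \<gamma>' t \<noteq> 0))"

definition piecewise_C1_regular :: "(real \<Rightarrow> real \<times> real) \<Rightarrow> bool" where
  "piecewise_C1_regular \<gamma> \<longleftrightarrow>
     (\<exists>(n::nat) \<tau>. \<tau> 0 = 0 \<and> \<tau> n = 1 \<and>
       (\<forall>i<n. \<tau> i < \<tau> (Suc i) \<and> C1_regular_on \<gamma> (\<tau> i) (\<tau> (Suc i))))"

definition piecewise_C1_boundary :: "(real \<times> real) set \<Rightarrow> (real \<Rightarrow> real \<times> real) \<Rightarrow> bool" where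
  "piecewise_C1_boundary \<Omega> \<gamma> \<longleftrightarrow>
     simple_path \<gamma> \<and> pathfinish \<gamma> = pathstart \<gamma> \<and> path_image \<gamma> = frontier \<Omega> \<and>
     piecewise_C1_regular \<gamma>"

text \<open>\<open>\<gamma>\<close> is a parametrisation of the boundary. The normal is prescribed at all
  but finitely many boundary points; its values at corners are left arbitrary.\<close>

definition exterior_unit_normal ::
    "(real \<times> real) set \<Rightarrow> (real \<Rightarrow> real \<times> real) \<Rightarrow> (real \<times> real \<Rightarrow> real \<times> real) \<Rightarrow> bool" where
  "exterior_unit_normal \<Omega> \<gamma> \<eta> \<longleftrightarrow>
     (\<forall>t\<in>{0<..<1}. \<gamma> differentiable (at t) \<longrightarrow>
        norm (\<eta> (\<gamma> t)) = 1 \<and>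
        \<eta> (\<gamma> t) \<bullet> vector_derivative \<gamma> (at t) = 0 \<and>
        (\<forall>\<^sub>F s in at_right 0. \<gamma> t + s *\<^sub>R \<eta> (\<gamma> t) \<notin> closure \<Omega>))"

text \<open>The integral of \<open>h\<close> with respect to arc length over a subset \<open>\<Gamma>\<close> of the curve that is
  parametrised by \<open>\<gamma>\<close>.\<close>

definition arclength_integral ::
    "(real \<Rightarrow> real \<times> real) \<Rightarrow> (real \<times> real) set \<Rightarrow> (real \<times> real \<Rightarrow> real) \<Rightarrow> real" where
  "arclength_integral \<gamma> \<Gamma> h =
     (LINT t:{t\<in>{0..1}. \<gamma> t \<in> \<Gamma>}|lborel. h (\<gamma> t) * norm (vector_derivative \<gamma> (at t)))"


section \<open>The Tricomi domain\<close>

text \<open>Half-integer powers are taken of nonnegative reals only and are written with \<open>powr\<close>. The exponent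
  \<open>(m2 + 2) div 2\<close> is a natural number (exact, and odd, when \<open>m2\<close> is divisible by 4), so that powers of
  negative numbers make sense.\<close>

definition tricomi_yC :: "nat \<Rightarrow> nat \<Rightarrow> real \<Rightarrow> real" where
  "tricomi_yC m1 m2 x0 =
     - ((- (1 / 2) * ((real m1 + 2) / (real m2 + 2)) * (2 * x0) ^ ((m2 + 2) div 2))
          powr (2 / (real m1 + 2)))"

definition tricomi_AC :: "nat \<Rightarrow> nat \<Rightarrow> real \<Rightarrow> (real \<times> real) set" where
  "tricomi_AC m1 m2 x0 =
     {(x, y). x \<le> 0 \<and> tricomi_yC m1 m2 x0 \<le> y \<and> y \<le> 0 \<and>
        2 / (real m1 + 2) * (- y) powr ((real m1 + 2) / 2) =
        2 / (real m2 + 2) * (x ^ ((m2 + 2) div 2) - (2 * x0) ^ ((m2 + 2) div 2))}"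

definition tricomi_BC :: "nat \<Rightarrow> nat \<Rightarrow> real \<Rightarrow> (real \<times> real) set" where
  "tricomi_BC m1 m2 x0 =
     {(x, y). x \<le> 0 \<and> tricomi_yC m1 m2 x0 \<le> y \<and> y \<le> 0 \<and>
        2 / (real m1 + 2) * (- y) powr ((real m1 + 2) / 2) =
        - (2 / (real m2 + 2)) * x ^ ((m2 + 2) div 2)}"

definition tricomi_domain ::
    "nat \<Rightarrow> nat \<Rightarrow> real \<Rightarrow> (real \<times> real) set \<Rightarrow> (real \<times> real) set \<Rightarrow> bool" where
  "tricomi_domain m1 m2 x0 \<Omega> \<sigma> \<longleftrightarrow>
     open \<Omega> \<and> bounded \<Omega> \<and> simply_connected \<Omega> \<and>
     frontier \<Omega> = \<sigma> \<union> tricomi_AC m1 m2 x0 \<union> tricomi_BC m1 m2 x0 \<and>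
     (\<exists>s. arc s \<and> path_image s = \<sigma> \<and> pathstart s = (2 * x0, 0) \<and> pathfinish s = (0, 0)) \<and>
     \<sigma> - {(2 * x0, 0), (0, 0)} \<subseteq> {(x, y). y > 0}"


section \<open>The operator and the boundary forms\<close>

definition tricomi_op ::
    "nat \<Rightarrow> nat \<Rightarrow> (real \<times> real) set \<Rightarrow> (real \<times> real \<Rightarrow> real) \<Rightarrow> real \<times> real \<Rightarrow> real" where
  "tricomi_op m1 m2 \<Omega> u = (\<lambda>(x, y).
     - (y ^ m1) * partial_x \<Omega> (partial_x \<Omega> u) (x, y)
     - x ^ m2 * partial_y \<Omega> (partial_y \<Omega> u) (x, y))"

definition D_field :: "nat \<Rightarrow> nat \<Rightarrow> real \<times> real \<Rightarrow> real \<times> real" where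
  "D_field m1 m2 = (\<lambda>(x, y). (- (real m1 + 2) * x, - (real m2 + 2) * y))"

definition D_deriv ::
    "nat \<Rightarrow> nat \<Rightarrow> (real \<times> real) set \<Rightarrow> (real \<times> real \<Rightarrow> real) \<Rightarrow> real \<times> real \<Rightarrow> real" where
  "D_deriv m1 m2 \<Omega> u = (\<lambda>(x, y).
     - (real m1 + 2) * x * partial_x \<Omega> u (x, y) - (real m2 + 2) * y * partial_y \<Omega> u (x, y))"

definition tricomi_flux ::
    "nat \<Rightarrow> nat \<Rightarrow> (real \<times> real) set \<Rightarrow> (real \<times> real \<Rightarrow> real) \<Rightarrow> real \<times> real \<Rightarrow> real \<times> real" where
  "tricomi_flux m1 m2 \<Omega> u = (\<lambda>(x, y).
     (- (y ^ m1) * partial_x \<Omega> u (x, y), - (x ^ m2) * partial_y \<Omega> u (x, y)))"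

definition omega1 ::
    "nat \<Rightarrow> nat \<Rightarrow> (real \<times> real) set \<Rightarrow> (real \<times> real \<Rightarrow> real) \<Rightarrow> (real \<times> real \<Rightarrow> real \<times> real)
      \<Rightarrow> real \<times> real \<Rightarrow> real" where
  "omega1 m1 m2 \<Omega> u \<eta> = (\<lambda>(x, y).
     ((2 * D_deriv m1 m2 \<Omega> u (x, y)) *\<^sub>R tricomi_flux m1 m2 \<Omega> u (x, y)
      + (y ^ m1 * (partial_x \<Omega> u (x, y))\<^sup>2 + x ^ m2 * (partial_y \<Omega> u (x, y))\<^sup>2)
          *\<^sub>R D_field m1 m2 (x, y)) \<bullet> \<eta> (x, y))"

definition omega2 ::
    "nat \<Rightarrow> nat \<Rightarrow> (real \<times> real) set \<Rightarrow> (real \<Rightarrow> real) \<Rightarrow> (real \<times> real \<Rightarrow> real)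
      \<Rightarrow> (real \<times> real \<Rightarrow> real \<times> real) \<Rightarrow> real \<times> real \<Rightarrow> real" where
  "omega2 m1 m2 \<Omega> F u \<eta> = (\<lambda>p.
     ((- 2 * F (u p)) *\<^sub>R D_field m1 m2 p
      - ((real m1 + real m2 + real m1 * real m2) * u p) *\<^sub>R tricomi_flux m1 m2 \<Omega> u p) \<bullet> \<eta> p)"

end

theory Submission
  imports Defs
begin

text \<open>
  The identity is of Pohozaev type: multiply the equation by \<open>Du\<close> and by \<open>u\<close>, where \<open>- D\<close> generates the
  anisotropic dilations adapted to the operator, and integrate by parts. Concretely, the fields with
  normal components \<open>\<omega>\<^sub>1\<close> and \<open>\<omega>\<^sub>2\<close> have divergences that add up to
  \<open>2 (m1 + m2 + 4) F(u) - (m1 + m2 + m1 m2) u f(u)\<close> for a solution \<open>u\<close>; the computation is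
  \<open>pohozaev_algebraic_identity\<close> together with the equality of the mixed second derivatives. The divergence
  theorem gives the claim with both boundary integrals extended over the whole boundary.

  It remains to see which parts of the boundary contribute. Where \<open>u\<close> vanishes so does \<open>\<omega>\<^sub>2\<close>, because
  \<open>F(0) = 0\<close>. On \<open>AC\<close> also \<open>\<omega>\<^sub>1\<close> vanishes: since \<open>u = 0\<close> there, the gradient of \<open>u\<close> is normal to the
  curve (\<open>tangential_derivative_zero\<close>), and since the curve is characteristic the quadratic form
  \<open>y\<^sup>m\<^sup>1 u\<^sub>x\<^sup>2 + x\<^sup>m\<^sup>2 u\<^sub>y\<^sup>2\<close> and the flux in normal direction are then zero
  (\<open>characteristic_forms_vanish\<close>).

  The main analytic work is the divergence theorem for a domain whose boundary is a piecewise \<open>C\<^sup>1\<close> curve,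
  with arbitrary corners and fields that live on the closure only. It is proved one coordinate at a
  time. On almost every horizontal line the domain is a finite union of intervals whose ends are points
  where the curve crosses the line, so the integral of an \<open>x\<close>-derivative over the line is a sum of
  boundary values with signs; the sign is that of the first component of the exterior normal
  (\<open>crossing\<close>, \<open>slice_integral\<close>). Integrating this sum over all heights gives the boundary integral, by
  the one-dimensional area formula applied to the height of the curve
  (\<open>lebesgue_integral_eq_sum_over_fibres\<close>). Heights of corners and of horizontal tangents are negligible
  by Sard's theorem.
\<close>

section \<open>Sard's theorem, the area formula and the fundamental theorem in dimension one\<close>

text \<open>The one-dimensional case of Sard's theorem, obtained from its version for vectors by
  identifying the reals with vectors of length one.\<close>

lemma negligible_critical_values:
  fixes h :: "real \<Rightarrow> real"
  assumes "\<And>t. t \<in> S \<Longrightarrow> (h has_real_derivative 0) (at t within S)"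
  shows "negligible (h ` S)"
proof -
  let ?k = "\<lambda>x::real^1. (vec (h (x $ 1)) :: real^1)"
  have "negligible (?k ` (vec ` S))"
  proof (rule baby_Sard[where f' = "\<lambda>x y. 0"])
    fix x :: "real^1" assume x: "x \<in> vec ` S"
    then obtain t where t: "t \<in> S" "x = vec t" by auto
    have 1: "(h has_derivative (\<lambda>y. 0)) (at (x $ 1) within (\<lambda>x::real^1. x $ 1) ` (vec ` S))"
      using assms[OF t(1)] t(2) by (simp add: has_field_derivative_def image_image lambda_zero[symmetric])
    have 2: "((\<lambda>x::real^1. x $ 1) has_derivative (\<lambda>x. x $ 1)) (at x within vec ` S)"
      by (intro bounded_linear_imp_has_derivative bounded_linear_vec_nth)
    have 3: "((\<lambda>x::real^1. h (x $ 1)) has_derivative (\<lambda>y. 0)) (at x within vec ` S)"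
      using has_derivative_in_compose[OF 2 1] by simp
    have 4: "bounded_linear (vec :: real \<Rightarrow> real^1)"
      by (simp add: linear_linear bounded_linear_vec_nth linear_vec linear_conv_bounded_linear[symmetric])
    show "(?k has_derivative (\<lambda>y. 0)) (at x within vec ` S)"
      using bounded_linear.has_derivative[OF 4 3] by (simp add: vec_eq_iff zero_vec_def)
  next
    show "rank (matrix (\<lambda>y::real^1. 0::real^1)) < CARD(1)"
      by (simp add: matrix_def rank_eq_0 zero_vec_def[symmetric] vec_eq_iff)
  qed simp
  then have "negligible ((\<lambda>x::real^1. x $ 1) ` (?k ` (vec ` S)))"
    by (rule negligible_differentiable_image_negligible[rotated])
       (auto intro!: linear_imp_differentiable_on simp: bounded_linear.linear[OF bounded_linear_vec_nth])
  then show ?thesis by (simp add: image_image)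
qed

lemma inj_on_of_deriv_nonzero:
  fixes h h' :: "real \<Rightarrow> real"
  assumes "connected J"
    and D: "\<And>t. t \<in> J \<Longrightarrow> (h has_real_derivative h' t) (at t)" and nz: "\<And>t. t \<in> J \<Longrightarrow> h' t \<noteq> 0"
  shows "inj_on h J"
proof (rule inj_onI, rule ccontr)
  fix a b assume ab: "a \<in> J" "b \<in> J" "h a = h b" "a \<noteq> b"
  define c d where "c = min a b" and "d = max a b"
  have cd: "c < d" "c \<in> J" "d \<in> J" "h c = h d" using ab by (auto simp: c_def d_def min_def max_def)
  have sub: "{c..d} \<subseteq> J"
    using assms(1) cd(2,3) unfolding is_interval_connected_1[symmetric]
    by (metis interval_subset_is_interval[of J c d] box_real(2))
  have "\<exists>z>c. z < d \<and> DERIV h z :> 0"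
  proof (rule Rolle[OF cd(1,4)])
    show "continuous_on {c..d} h"
      by (meson D sub subsetD DERIV_isCont continuous_at_imp_continuous_on)
    show "h differentiable (at x)" if "c < x" "x < d" for x
      using D[of x] subsetD[OF sub, of x] that by (auto simp: real_differentiable_def)
  qed
  then obtain z where z: "c < z" "z < d" "DERIV h z :> 0" by auto
  have "z \<in> J" using subsetD[OF sub, of z] z by auto
  then show False using DERIV_unique[OF D z(3)] nz by auto
qed

text \<open>The area formula for a real function that need not be injective. Since the derivative does
  not vanish, \<open>U\<close> is a countable union of intervals on which \<open>h\<close> is injective; disjointifying them
  leaves Borel pieces on which the injective change of variables applies, and the contributions of
  the pieces over a value \<open>y\<close> add up to the sum over the fibre of \<open>y\<close>. The sum over an infinite fibre
  has the default value \<open>0\<close>, which is harmless because such fibres lie over a null set only.\<close>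

lemma lebesgue_integral_eq_sum_over_fibres:
  fixes h h' g :: "real \<Rightarrow> real"
  assumes U: "open U"
    and deriv: "\<And>t. t \<in> U \<Longrightarrow> (h has_real_derivative h' t) (at t)"
    and cont: "continuous_on U h'" and nz: "\<And>t. t \<in> U \<Longrightarrow> h' t \<noteq> 0"
    and int: "(\<lambda>t. \<bar>h' t\<bar> * g t) absolutely_integrable_on U"
    and fin: "negligible {y. \<not> finite {t\<in>U. h t = y}}"
  shows "(LINT t:U|lebesgue. \<bar>h' t\<bar> * g t) = (LINT y|lebesgue. (\<Sum>t\<in>{t\<in>U. h t = y}. g t))"
proof -
  define \<B> where "\<B> = {S. open S \<and> connected S \<and> S \<subseteq> U}"
  have U_union: "\<Union>\<B> = U"
  proof
    show "U \<subseteq> \<Union>\<B>"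
    proof
      fix t assume "t \<in> U"
      then obtain e where "e > 0" "ball t e \<subseteq> U" using U openE by blast
      then have "ball t e \<in> \<B>" "t \<in> ball t e" by (auto simp: \<B>_def)
      then show "t \<in> \<Union>\<B>" by blast
    qed
  qed (auto simp: \<B>_def)
  obtain \<C> where \<C>: "\<C> \<subseteq> \<B>" "countable \<C>" "\<Union>\<C> = \<Union>\<B>"
    using Lindelof[of \<B>] by (auto simp: \<B>_def)
  define J where "J = from_nat_into (insert {} \<C>)"
  have J_range: "range J = insert {} \<C>"
    unfolding J_def using \<C>(2) by (simp add: range_from_nat_into)
  have J: "open (J n)" "connected (J n)" "J n \<subseteq> U" for n
  proof -
    have "J n \<in> insert {} \<C>" using J_range by blast
    then show "open (J n)" "connected (J n)" "J n \<subseteq> U" using \<C>(1) by (auto simp: \<B>_def)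
  qed
  have inj_J: "inj_on h (J n)" for n
    by (rule inj_on_of_deriv_nonzero[OF J(2), of _ h h']) (use J(3) deriv nz in blast)+
  define E where "E = disjointed J"
  have E_sub: "E n \<subseteq> J n" for n by (simp add: E_def disjointed_subset)
  have E_disj: "i \<noteq> j \<Longrightarrow> E i \<inter> E j = {}" for i j
    using disjoint_family_disjointed[of J] by (auto simp: E_def disjoint_family_on_def)
  have E_Un: "(\<Union>n. E n) = U"
    using UN_disjointed_eq[of J] J_range \<C>(3) U_union by (simp add: E_def)
  have E_borel: "E n \<in> sets borel" for n
  proof -
    have "range E \<subseteq> sets borel" unfolding E_def
      by (rule sets.range_disjointed_sets) (auto simp: J)
    then show ?thesis by blast
  qed
  then have E_meas: "E n \<in> sets lebesgue" for n by simp
  have inj_E: "inj_on h (E n)" for n using inj_J E_sub inj_on_subset by blast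
  define f where "f n y = (if y \<in> h ` E n then g (the_inv_into (E n) h y) else 0)" for n y
  have f_h: "f n (h t) = g t" if "t \<in> E n" for n t
    using that inj_E by (auto simp: f_def the_inv_into_f_f)
  have der_E: "(h has_real_derivative h' t) (at t within E n)" if "t \<in> E n" for n t
    using deriv[of t] that E_Un has_field_derivative_at_within by blast
  have int_E: "(\<lambda>t. \<bar>h' t\<bar> * g t) absolutely_integrable_on E n" for n
    using int E_meas E_Un set_integrable_subset by (metis UN_upper UNIV_I)
  have f_int: "f n absolutely_integrable_on h ` E n \<and>
      (LINT y:h ` E n|lebesgue. f n y) = (LINT t:E n|lebesgue. \<bar>h' t\<bar> * g t)"
    and f_int_abs: "(LINT y:h ` E n|lebesgue. \<bar>f n y\<bar>) = (LINT t:E n|lebesgue. \<bar>\<bar>h' t\<bar> * g t\<bar>)" for n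
  proof -
    have cov: "(\<lambda>y. k (f n y)) absolutely_integrable_on h ` E n \<and>
        (LINT y:h ` E n|lebesgue. k (f n y)) = (LINT t:E n|lebesgue. \<bar>h' t\<bar> * k (g t))"
      if k: "(\<lambda>t. \<bar>h' t\<bar> * k (g t)) absolutely_integrable_on E n" for k
    proof -
      have eq: "\<bar>h' t\<bar> * k (f n (h t)) = \<bar>h' t\<bar> * k (g t)" if "t \<in> E n" for t
        using f_h[OF that] by simp
      have ai: "(\<lambda>t. \<bar>h' t\<bar> * k (f n (h t))) absolutely_integrable_on E n"
        using k by (rule set_integrable_cong[OF refl refl eq, THEN iffD2, rotated -1]) auto
      have *: "(\<lambda>y. k (f n y)) absolutely_integrable_on h ` E n \<and>
         integral (h ` E n) (\<lambda>y. k (f n y)) = integral (E n) (\<lambda>t. \<bar>h' t\<bar> * k (f n (h t)))"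
        by (rule has_absolute_integral_change_of_variables_1'
            [OF E_meas der_E inj_E, of n "\<lambda>y. k (f n y)" "integral (E n) (\<lambda>t. \<bar>h' t\<bar> * k (f n (h t)))", THEN iffD1])
           (use ai in auto)
      then show ?thesis
        using set_lebesgue_integral_eq_integral(2)[OF conjunct1[OF *]] set_lebesgue_integral_eq_integral(2)[OF k]
        by (simp add: eq cong: integral_cong)
    qed
    show "f n absolutely_integrable_on h ` E n \<and>
      (LINT y:h ` E n|lebesgue. f n y) = (LINT t:E n|lebesgue. \<bar>h' t\<bar> * g t)"
      using cov[of "\<lambda>x. x"] int_E by simp
    have "(\<lambda>t. \<bar>h' t\<bar> * \<bar>g t\<bar>) absolutely_integrable_on E n"
      using set_integrable_abs[OF int_E[of n]] by (simp add: abs_mult)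
    from cov[of abs, OF this]
    show "(LINT y:h ` E n|lebesgue. \<bar>f n y\<bar>) = (LINT t:E n|lebesgue. \<bar>\<bar>h' t\<bar> * g t\<bar>)"
      by (simp add: abs_mult)
  qed
  have f_ind: "indicat_real (h ` E n) y *\<^sub>R f n y = f n y"
       "indicat_real (h ` E n) y *\<^sub>R \<bar>f n y\<bar> = \<bar>f n y\<bar>" for n y
    by (auto simp: f_def)
  have f_integrable: "integrable lebesgue (f n)" for n
    using conjunct1[OF f_int[of n]] by (simp add: set_integrable_def f_def[abs_def] if_distrib f_ind cong: if_cong)
  have f_integral: "integral\<^sup>L lebesgue (f n) = (LINT t:E n|lebesgue. \<bar>h' t\<bar> * g t)" for n
    using conjunct2[OF f_int[of n]] unfolding set_lebesgue_integral_def f_ind by simp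
  have f_abs: "(LINT y|lebesgue. norm (f n y)) = (LINT t:E n|lebesgue. \<bar>\<bar>h' t\<bar> * g t\<bar>)" for n
    using f_int_abs[of n] unfolding set_lebesgue_integral_def f_ind by simp
  \<comment> \<open>A fibre that is finite meets only finitely many of the pieces, and each of them at most once.\<close>
  have fibre: "finite {n. f n y \<noteq> 0} \<and> (\<Sum>n. f n y) = (\<Sum>t\<in>{t\<in>U. h t = y}. g t)"
    if fy: "finite {t\<in>U. h t = y}" for y
  proof -
    let ?T = "{t\<in>U. h t = y}"
    have "\<forall>t\<in>?T. \<exists>n. t \<in> E n" using E_Un by blast
    then obtain N where N: "\<And>t. t \<in> ?T \<Longrightarrow> t \<in> E (N t)" by metis
    have injN: "inj_on N ?T"
    proof (rule inj_onI)
      fix s t assume "s \<in> ?T" "t \<in> ?T" "N s = N t"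
      then show "s = t" using N[of s] N[of t] inj_E[of "N t"] by (auto dest: inj_onD)
    qed
    have zero: "f n y = 0" if "n \<notin> N ` ?T" for n
    proof -
      have "y \<notin> h ` E n"
      proof
        assume "y \<in> h ` E n"
        then obtain t where t: "t \<in> E n" "y = h t" by auto
        then have tT: "t \<in> ?T" using E_Un by auto
        then have "N t = n" using E_disj[of "N t" n] N[OF tT] t by blast
        then show False using that tT by blast
      qed
      then show ?thesis by (simp add: f_def)
    qed
    have "(\<Sum>n. f n y) = (\<Sum>n\<in>N ` ?T. f n y)"
      using fy zero by (intro suminf_finite) auto
    also have "\<dots> = (\<Sum>t\<in>?T. f (N t) y)" using injN by (simp add: sum.reindex)
    also have "\<dots> = (\<Sum>t\<in>?T. g t)"
      using N f_h by (intro sum.cong refl) fastforce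
    finally have "(\<Sum>n. f n y) = (\<Sum>t\<in>?T. g t)" .
    moreover have "finite {n. f n y \<noteq> 0}"
      using zero fy by (blast intro: finite_subset[of _ "N ` ?T"])
    ultimately show ?thesis by simp
  qed
  have AE_fin: "AE y in lebesgue. finite {t\<in>U. h t = y}"
    using fin by (intro AE_I'[where N = "{y. \<not> finite {t\<in>U. h t = y}}"])
      (auto simp: negligible_iff_null_sets)
  have AE_summable: "AE y in lebesgue. summable (\<lambda>n. norm (f n y))"
    using AE_fin
  proof eventually_elim
    case (elim y)
    then have "finite {n. f n y \<noteq> 0}" using fibre by blast
    then show ?case by (intro summable_finite) auto
  qed
  have summable_int: "summable (\<lambda>n. LINT y|lebesgue. norm (f n y))"
  proof -
    let ?p = "\<lambda>t. \<bar>\<bar>h' t\<bar> * g t\<bar>"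
    have iU: "set_integrable lebesgue U ?p" using set_integrable_abs[OF int] by simp
    have iE: "set_integrable lebesgue (E n) ?p" for n using set_integrable_abs[OF int_E] by simp
    show ?thesis unfolding f_abs
    proof (rule summableI_nonneg_bounded)
      fix n
      show "0 \<le> (LINT t:E n|lebesgue. ?p t)" unfolding set_lebesgue_integral_def by (rule integral_nonneg_AE) simp
      have "(\<Sum>i<n. LINT t:E i|lebesgue. ?p t) = (LINT t|lebesgue. (\<Sum>i<n. indicat_real (E i) t *\<^sub>R ?p t))"
        unfolding set_lebesgue_integral_def
        by (rule Bochner_Integration.integral_sum[symmetric]) (use iE in \<open>simp add: set_integrable_def\<close>)
      also have "\<dots> \<le> (LINT t:U|lebesgue. ?p t)"
        unfolding set_lebesgue_integral_def
      proof (rule integral_mono)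
        show "integrable lebesgue (\<lambda>t. \<Sum>i<n. indicat_real (E i) t *\<^sub>R ?p t)"
          using iE by (intro Bochner_Integration.integrable_sum) (simp add: set_integrable_def)
        show "integrable lebesgue (\<lambda>t. indicat_real U t *\<^sub>R ?p t)" using iU by (simp add: set_integrable_def)
        fix t
        have "(\<Sum>i<n. indicat_real (E i) t) = indicat_real (\<Union>i<n. E i) t"
          using E_disj by (intro indicator_UN_disjoint[symmetric]) (auto simp: disjoint_family_on_def)
        also have "\<dots> \<le> indicat_real U t" using E_Un by (auto simp: indicator_def)
        finally show "(\<Sum>i<n. indicat_real (E i) t *\<^sub>R ?p t) \<le> indicat_real U t *\<^sub>R ?p t"
          by (simp add: sum_distrib_right[symmetric] mult_right_mono)
      qed
      finally show "(\<Sum>i<n. LINT t:E i|lebesgue. ?p t) \<le> (LINT t:U|lebesgue. ?p t)" .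
    qed
  qed
  have "(LINT y|lebesgue. (\<Sum>t\<in>{t\<in>U. h t = y}. g t)) = (LINT y|lebesgue. (\<Sum>n. f n y))"
  proof -
    have m: "(\<lambda>y. \<Sum>n. f n y) \<in> borel_measurable lebesgue"
      using f_integrable borel_measurable_suminf by blast
    have ae: "AE y in lebesgue. (\<Sum>n. f n y) = (\<Sum>t\<in>{t\<in>U. h t = y}. g t)"
      using AE_fin by eventually_elim (use fibre in auto)
    then have m': "(\<lambda>y. \<Sum>t\<in>{t\<in>U. h t = y}. g t) \<in> borel_measurable lebesgue"
      by (rule borel_measurable_AE[OF m])
    show ?thesis by (rule integral_cong_AE[OF m' m]) (use ae in auto)
  qed
  also have "\<dots> = (\<Sum>n. integral\<^sup>L lebesgue (f n))"
    by (rule integral_suminf[OF f_integrable AE_summable summable_int])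
  also have "\<dots> = (\<Sum>n. LINT t:E n|lebesgue. \<bar>h' t\<bar> * g t)" by (simp add: f_integral)
  also have "\<dots> = (LINT t:(\<Union>n. E n)|lebesgue. \<bar>h' t\<bar> * g t)"
    by (rule lebesgue_integral_countable_add[symmetric, OF E_meas E_disj]) (simp_all add: E_Un int)
  finally show ?thesis by (simp add: E_Un)
qed

text \<open>The fundamental theorem of calculus on a finite union of open intervals. The weight of \<open>z\<close> is
  \<open>1\<close> at a right end of a component, \<open>-1\<close> at a left end, and \<open>0\<close> if \<open>S\<close> lies on both sides or on neither
  side of \<open>z\<close>; hence \<open>Z\<close> may contain points besides the frontier. The induction cuts \<open>S\<close> at the second
  largest element of \<open>Z\<close>, and the interval cut off is a gap either contained in \<open>S\<close> or disjoint from it.\<close>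

lemma has_integral_open_set_finite_frontier:
  fixes f f' :: "real \<Rightarrow> real"
  assumes "finite Z" "open S" "bounded S" "frontier S \<subseteq> Z"
    and "continuous_on (closure S) f"
    and "\<And>x. x \<in> S \<Longrightarrow> (f has_real_derivative f' x) (at x)"
  shows "(f' has_integral (\<Sum>z\<in>Z. f z * (of_bool (\<forall>\<^sub>F x in at_left z. x \<in> S)
            - of_bool (\<forall>\<^sub>F x in at_right z. x \<in> S)))) S"
  using assms
proof (induction "card Z" arbitrary: Z S rule: less_induct)
  case less
  have side: "I \<subseteq> S \<or> I \<inter> S = {}" if "connected I" "I \<inter> Z = {}" for I
    using connected_Int_frontier[of I S] that less.prems(4) by blast
  show ?case
  proof (cases "Z = {}")
    case True
    then have "S = {} \<or> S = UNIV" using side[of UNIV] by auto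
    then have "S = {}" using less.prems(3) not_bounded_UNIV by blast
    then show ?thesis using True by simp
  next
    case False
    define M where "M = Max Z"
    have M: "M \<in> Z" "\<And>z. z \<in> Z \<Longrightarrow> z \<le> M"
      using False less.prems(1) by (auto simp: M_def)
    have right_empty: "{M<..} \<inter> S = {}"
    proof -
      have "\<not> {M<..} \<subseteq> S"
      proof
        assume "{M<..} \<subseteq> S"
        moreover obtain B where "\<And>x. x \<in> S \<Longrightarrow> \<bar>x\<bar> \<le> B"
          using less.prems(3) by (auto simp: bounded_iff)
        moreover have "M < max M B + 1" by linarith
        ultimately have "\<bar>max M B + 1\<bar> \<le> B" by blast
        then show False by linarith
      qed
      moreover have "connected {M<..}" "{M<..} \<inter> Z = {}"
        using M(2) by (auto simp: disjoint_iff not_less[symmetric])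
      ultimately show ?thesis using side by blast
    qed
    have RM: "\<not> (\<forall>\<^sub>F x in at_right M. x \<in> S)"
    proof
      assume "\<forall>\<^sub>F x in at_right M. x \<in> S"
      then have "\<forall>\<^sub>F x in at_right M. False"
        using eventually_at_right_less[of M] by eventually_elim (use right_empty in auto)
      then show False by simp
    qed
    show ?thesis
    proof (cases "Z = {M}")
      case True
      have "\<not> {..<M} \<subseteq> S"
      proof
        assume "{..<M} \<subseteq> S"
        moreover obtain B where "\<And>x. x \<in> S \<Longrightarrow> \<bar>x\<bar> \<le> B"
          using less.prems(3) by (auto simp: bounded_iff)
        moreover have "min M (- B) - 1 < M" by linarith
        ultimately have "\<bar>min M (- B) - 1\<bar> \<le> B" by blast
        then show False by linarith
      qed
      moreover have "connected {..<M}" "{..<M} \<inter> Z = {}" using True by auto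
      ultimately have "{..<M} \<inter> S = {}" using side by blast
      then have "S \<subseteq> {M}" using right_empty by (auto simp: disjoint_iff) (metis linorder_neqE)
      then have "S = {}" using less.prems(2) by (metis finite.emptyI finite_insert finite_subset finite_imp_not_open)
      then show ?thesis by simp
    next
      case False
      define Z' where "Z' = Z - {M}"
      define M' where "M' = Max Z'"
      have Z': "Z' \<noteq> {}" "finite Z'" "Z = insert M Z'" "M \<notin> Z'"
        using False M(1) less.prems(1) by (auto simp: Z'_def)
      have M': "M' \<in> Z'" "\<And>z. z \<in> Z' \<Longrightarrow> z \<le> M'" using Z' by (auto simp: M'_def)
      have lt: "M' < M" using M M' Z' by (metis insert_iff order_le_less)
      define S' where "S' = S \<inter> {..<M'}"
      have "closure S' \<subseteq> {..M'}" by (rule closure_minimal) (auto simp: S'_def)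
      then have nM: "M \<notin> frontier S'" using lt by (auto simp: frontier_def)
      have "frontier S' \<subseteq> frontier S \<union> {M'}"
        using frontier_Int_subset[of S "{..<M'}"] by (auto simp: S'_def)
      then have fr: "frontier S' \<subseteq> Z'" using nM less.prems(4) M' Z' by auto
      have cl: "closure S' \<subseteq> closure S" by (rule closure_mono) (auto simp: S'_def)
      let ?L = "\<lambda>S z. of_bool (\<forall>\<^sub>F x in at_left z. x \<in> S) :: real"
      let ?R = "\<lambda>S z. of_bool (\<forall>\<^sub>F x in at_right z. x \<in> S) :: real"
      have IH: "(f' has_integral (\<Sum>z\<in>Z'. f z * (?L S' z - ?R S' z))) S'"
      proof (rule less.hyps)
        show "card Z' < card Z" using Z' by simp
        show "open S'" "bounded S'" using less.prems(2,3) by (auto simp: S'_def bounded_Int)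
        show "continuous_on (closure S') f" using less.prems(5) cl continuous_on_subset by blast
      qed (use Z' fr less.prems(6) in \<open>auto simp: S'_def\<close>)
      have L_eq: "?L S' z = ?L S z" if "z \<in> Z'" for z
      proof -
        have "\<forall>\<^sub>F x in at_left z. x < M'"
          using M'(2)[OF that] by (auto simp: eventually_at_filter)
        then have "(\<forall>\<^sub>F x in at_left z. x \<in> S') = (\<forall>\<^sub>F x in at_left z. x \<in> S)"
          by (intro eventually_cong) (auto simp: S'_def elim: eventually_mono)
        then show ?thesis by simp
      qed
      have R_eq: "?R S' z = ?R S z" if "z \<in> Z'" "z \<noteq> M'" for z
      proof -
        have "z < M'" using M'(2)[OF that(1)] that(2) by simp
        then have "\<forall>\<^sub>F x in at_right z. x < M'"
          by (metis eventually_at_right_field)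
        then have "(\<forall>\<^sub>F x in at_right z. x \<in> S') = (\<forall>\<^sub>F x in at_right z. x \<in> S)"
          by (intro eventually_cong) (auto simp: S'_def elim: eventually_mono)
        then show ?thesis by simp
      qed
      have R0: "?R S' M' = 0"
      proof -
        have "\<not> (\<forall>\<^sub>F x in at_right M'. x \<in> S')"
        proof
          assume "\<forall>\<^sub>F x in at_right M'. x \<in> S'"
          then have "\<forall>\<^sub>F x in at_right M'. False"
            using eventually_at_right_less[of M'] by eventually_elim (auto simp: S'_def)
          then show False by simp
        qed
        then show ?thesis by simp
      qed
      have "{M'<..<M} \<inter> Z = {}" using M'(2) Z'(3) by (auto simp: disjoint_iff) (metis not_le)
      then have gap: "{M'<..<M} \<subseteq> S \<or> {M'<..<M} \<inter> S = {}" by (intro side) auto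
      have evR: "\<forall>\<^sub>F x in at_right M'. x \<in> {M'<..<M}" and evL: "\<forall>\<^sub>F x in at_left M. x \<in> {M'<..<M}"
        using eventually_at_right_real[OF lt] eventually_at_left_real[OF lt] by auto
      \<comment> \<open>Both one-sided conditions at the ends of the gap say the same thing, so that the weights of
      \<open>M'\<close> in \<open>S\<close> and in \<open>S'\<close> differ exactly by the boundary term of the gap.\<close>
      have R_gap: "(\<forall>\<^sub>F x in at_right M'. x \<in> S) \<longleftrightarrow> {M'<..<M} \<subseteq> S"
      proof
        assume "\<forall>\<^sub>F x in at_right M'. x \<in> S"
        then have "\<exists>x. x \<in> S \<and> x \<in> {M'<..<M}"
          using eventually_happens'[OF _ eventually_conj[OF _ evR]] by auto
        then show "{M'<..<M} \<subseteq> S" using gap by blast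
      qed (rule eventually_mono[OF evR], blast)
      have L_gap: "(\<forall>\<^sub>F x in at_left M. x \<in> S) \<longleftrightarrow> {M'<..<M} \<subseteq> S"
      proof
        assume "\<forall>\<^sub>F x in at_left M. x \<in> S"
        then have "\<exists>x. x \<in> S \<and> x \<in> {M'<..<M}"
          using eventually_happens'[OF _ eventually_conj[OF _ evL]] by auto
        then show "{M'<..<M} \<subseteq> S" using gap by blast
      qed (rule eventually_mono[OF evL], blast)
      let ?c = "of_bool ({M'<..<M} \<subseteq> S) :: real"
      have gap_int: "(f' has_integral (?c * (f M - f M'))) (S \<inter> {M'<..<M})"
      proof (cases "{M'<..<M} \<subseteq> S")
        case True
        have "{M'..M} = closure {M'<..<M}" using lt by simp
        also have "\<dots> \<subseteq> closure S" using True by (rule closure_mono)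
        finally have "continuous_on {M'..M} f" using less.prems(5) continuous_on_subset by blast
        then have "(f' has_integral (f M - f M')) {M'..M}"
          using lt less.prems(6) True
          by (intro fundamental_theorem_of_calculus_interior)
             (auto simp: has_real_derivative_iff_has_vector_derivative[symmetric] subset_iff)
        moreover have "S \<inter> {M'<..<M} = {M'<..<M}" using True by auto
        ultimately show ?thesis using True by (simp add: has_integral_Icc_iff_Ioo)
      next
        case False
        then have "S \<inter> {M'<..<M} = {}" using gap by blast
        then show ?thesis using False by simp
      qed
      have "(f' has_integral ((\<Sum>z\<in>Z'. f z * (?L S' z - ?R S' z)) + ?c * (f M - f M'))) (S' \<union> S \<inter> {M'<..<M})"
        by (rule has_integral_Un[OF IH gap_int]) (auto simp: S'_def intro: negligible_subset[of "{}"])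
      then have "(f' has_integral ((\<Sum>z\<in>Z'. f z * (?L S' z - ?R S' z)) + ?c * (f M - f M'))) S"
      proof (rule has_integral_spike_set_eq[THEN iffD1, rotated 2])
        have "S - (S' \<union> S \<inter> {M'<..<M}) \<subseteq> {M', M}" using right_empty by (force simp: S'_def)
        then show "negligible {x \<in> S - (S' \<union> S \<inter> {M'<..<M}). f' x \<noteq> 0}"
          by (intro negligible_subset[OF negligible_finite[of "{M', M}"]]) auto
      qed (auto simp: S'_def intro: negligible_subset[of "{}"])
      moreover have "(\<Sum>z\<in>Z'. f z * (?L S' z - ?R S' z)) + ?c * (f M - f M')
          = (\<Sum>z\<in>Z. f z * (?L S z - ?R S z))"
      proof -
        have "(\<Sum>z\<in>Z' - {M'}. f z * (?L S' z - ?R S' z)) = (\<Sum>z\<in>Z' - {M'}. f z * (?L S z - ?R S z))"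
          using L_eq R_eq by (intro sum.cong) auto
        then show ?thesis
          using Z' M'(1) L_eq[OF M'(1)] R0 RM R_gap L_gap
          by (simp add: sum.remove[OF Z'(2) M'(1)] algebra_simps)
      qed
      ultimately show ?thesis by simp
    qed
  qed
qed

section \<open>The two sides of a parametrised boundary\<close>

text \<open>A piecewise \<open>C\<^sup>1\<close> boundary whose finitely many exceptional parameters (corners, and the two
  ends of the parameter interval) are collected in \<open>K\<close>. The velocity \<open>v\<close> is a parameter of its own, so
  that exchanging the two coordinates of the plane yields another instance of the same locale.\<close>

locale parametrised_boundary =
  fixes \<Omega> :: "(real \<times> real) set" and \<gamma> v :: "real \<Rightarrow> real \<times> real"
    and \<eta> :: "real \<times> real \<Rightarrow> real \<times> real" and K :: "real set"
  assumes open_\<Omega>: "open \<Omega>" and bounded_\<Omega>: "bounded \<Omega>"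
    and simple_\<gamma>: "simple_path \<gamma>" and image_\<gamma>: "path_image \<gamma> = frontier \<Omega>"
    and finite_K: "finite K" and ends_K: "0 \<in> K" "1 \<in> K"
    and deriv_\<gamma>: "\<And>t. t \<in> {0..1} - K \<Longrightarrow> (\<gamma> has_vector_derivative v t) (at t)"
    and v_nonzero: "\<And>t. t \<in> {0..1} - K \<Longrightarrow> v t \<noteq> 0"
    and cont_v: "continuous_on ({0..1} - K) v"
    and bounded_v: "bounded (v ` ({0..1} - K))"
    and normal: "\<And>t. t \<in> {0..1} - K \<Longrightarrow> norm (\<eta> (\<gamma> t)) = 1 \<and> \<eta> (\<gamma> t) \<bullet> v t = 0 \<and>
        (\<forall>\<^sub>F s in at_right 0. \<gamma> t + s *\<^sub>R \<eta> (\<gamma> t) \<notin> closure \<Omega>)"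
begin

definition smooth :: "real set" where "smooth = {0..1} - K"

text \<open>At these parameters the curve crosses the horizontal line through its current point.\<close>

definition transversal :: "real set" where "transversal = {t\<in>smooth. snd (v t) \<noteq> 0}"

text \<open>The sign is \<open>1\<close> where one leaves the domain by moving to the right, and \<open>-1\<close> where one enters it.\<close>

abbreviation \<epsilon> :: "real \<Rightarrow> real" where "\<epsilon> t \<equiv> sgn (fst (\<eta> (\<gamma> t)))"

lemma smooth_subset: "t \<in> smooth \<Longrightarrow> 0 < t \<and> t < 1"
  using ends_K by (auto simp: smooth_def order_less_le)

lemma open_smooth: "open smooth"
proof -
  have "smooth = {0<..<1} - K" using smooth_subset by (auto simp: smooth_def)
  then show ?thesis using finite_K by (simp add: open_Diff finite_imp_closed)
qed

lemma continuous_\<gamma>: "continuous_on {0..1} \<gamma>"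
  using simple_\<gamma> simple_path_imp_path by (auto simp: path_def)

lemma \<gamma>_frontier: "t \<in> {0..1} \<Longrightarrow> \<gamma> t \<in> frontier \<Omega>"
  using image_\<gamma> by (auto simp: path_image_def)

lemma inj_\<gamma>: "s \<in> smooth \<Longrightarrow> t \<in> {0..1} \<Longrightarrow> \<gamma> s = \<gamma> t \<Longrightarrow> s = t"
  using simple_\<gamma> smooth_subset[of s] unfolding simple_path_def loop_free_def by fastforce

lemma deriv_snd: "t \<in> smooth \<Longrightarrow> ((\<lambda>t. snd (\<gamma> t)) has_real_derivative snd (v t)) (at t)"
  using deriv_\<gamma>[of t] bounded_linear.has_vector_derivative[OF bounded_linear_snd]
  by (simp add: smooth_def has_real_derivative_iff_has_vector_derivative)

lemma open_transversal: "open transversal"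
proof -
  have "continuous_on smooth (\<lambda>t. snd (v t))" using cont_v by (auto simp: smooth_def intro!: continuous_intros)
  then have "open (smooth \<inter> (\<lambda>t. snd (v t)) -` (- {0}))"
    using open_smooth by (intro continuous_open_preimage) auto
  moreover have "transversal = smooth \<inter> (\<lambda>t. snd (v t)) -` (- {0})" by (auto simp: transversal_def)
  ultimately show ?thesis by simp
qed

lemma transversal_ball:
  assumes "t \<in> transversal" obtains r where "r > 0" "ball t r \<subseteq> transversal" "inj_on (\<lambda>t. snd (\<gamma> t)) (ball t r)"
proof -
  obtain r where r: "r > 0" "ball t r \<subseteq> transversal" using open_transversal assms openE by blast
  have "inj_on (\<lambda>t. snd (\<gamma> t)) (ball t r)"
    by (rule inj_on_of_deriv_nonzero[where h' = "\<lambda>t. snd (v t)"])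
       (use r(2) deriv_snd in \<open>auto simp: transversal_def\<close>)
  then show ?thesis using r that by blast
qed

lemma normal_fst_nonzero: assumes "t \<in> transversal" shows "fst (\<eta> (\<gamma> t)) \<noteq> 0"
proof
  assume "fst (\<eta> (\<gamma> t)) = 0"
  moreover have "norm (\<eta> (\<gamma> t)) = 1" "\<eta> (\<gamma> t) \<bullet> v t = 0" "snd (v t) \<noteq> 0"
    using normal[of t] assms by (auto simp: transversal_def smooth_def)
  ultimately show False by (auto simp: norm_prod_def inner_prod_def)
qed

lemma frontier_side: "connected B \<Longrightarrow> B \<inter> frontier \<Omega> = {} \<Longrightarrow> B \<subseteq> \<Omega> \<or> B \<inter> closure \<Omega> = {}"
  using connected_Int_frontier[of B \<Omega>] open_\<Omega>
  by (auto simp: frontier_def interior_open)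

text \<open>Near a transversal parameter the boundary is a graph over the vertical axis, and the domain lies
  on exactly one side of it. The map sending \<open>(t, s)\<close> to \<open>\<gamma> t + (s, 0)\<close> is injective near \<open>(t\<^sub>0, 0)\<close>, because the
  height of \<open>\<gamma>\<close> is, so by invariance of domain its image is a neighbourhood of \<open>\<gamma> t\<^sub>0\<close>. It meets the
  frontier only where \<open>s = 0\<close>, so the images of \<open>s > 0\<close> and of \<open>s < 0\<close>, being connected, each lie either
  inside \<open>\<Omega>\<close> or outside its closure. The exterior normal leads into one of these two sides, which is
  therefore outside; and as \<open>\<gamma> t\<^sub>0\<close> is a frontier point, the other side must be inside.\<close>

lemma crossing:
  assumes t0: "t\<^sub>0 \<in> transversal"
  obtains r s\<^sub>0 where "r > 0" "s\<^sub>0 > 0" "ball t\<^sub>0 r \<subseteq> transversal"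
    "\<And>t s. t \<in> ball t\<^sub>0 r \<Longrightarrow> 0 < s \<Longrightarrow> s < s\<^sub>0 \<Longrightarrow> \<gamma> t + (\<epsilon> t\<^sub>0 * s, 0) \<notin> closure \<Omega>"
    "\<And>t s. t \<in> ball t\<^sub>0 r \<Longrightarrow> 0 < s \<Longrightarrow> s < s\<^sub>0 \<Longrightarrow> \<gamma> t - (\<epsilon> t\<^sub>0 * s, 0) \<in> \<Omega>"
proof -
  let ?n = "\<eta> (\<gamma> t\<^sub>0)"
  have t0G: "t\<^sub>0 \<in> smooth" using t0 by (simp add: transversal_def)
  have n: "norm ?n = 1" "?n \<bullet> v t\<^sub>0 = 0"
    and ext: "\<forall>\<^sub>F s in at_right 0. \<gamma> t\<^sub>0 + s *\<^sub>R ?n \<notin> closure \<Omega>"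
    using normal[of t\<^sub>0] t0G by (auto simp: smooth_def)
  define e where "e = \<epsilon> t\<^sub>0"
  have e: "e = 1 \<or> e = -1" using normal_fst_nonzero[OF t0] by (auto simp: e_def sgn_if)
  obtain r1 where r1: "r1 > 0" "ball t\<^sub>0 r1 \<subseteq> transversal" and inj: "inj_on (\<lambda>t. snd (\<gamma> t)) (ball t\<^sub>0 r1)"
    using transversal_ball[OF t0] by blast
  define c where "c = \<bar>snd (v t\<^sub>0)\<bar> / 2"
  have c: "c > 0" using t0 by (simp add: c_def transversal_def)
  \<comment> \<open>Near \<open>t\<^sub>0\<close> the second coordinate moves at speed at least \<open>c\<close>, the normal component at most at half of it.\<close>
  have "\<exists>d>0. \<forall>t. norm (t - t\<^sub>0) < d \<longrightarrow> norm (\<gamma> t - \<gamma> t\<^sub>0 - (t - t\<^sub>0) *\<^sub>R v t\<^sub>0) \<le> c / 2 * norm (t - t\<^sub>0)"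
    using deriv_\<gamma>[of t\<^sub>0] t0G half_gt_zero[OF c]
    unfolding has_vector_derivative_def has_derivative_at_alt smooth_def by blast
  then obtain r2 where r2: "r2 > 0"
    and lin: "\<And>t. \<bar>t - t\<^sub>0\<bar> < r2 \<Longrightarrow> norm (\<gamma> t - \<gamma> t\<^sub>0 - (t - t\<^sub>0) *\<^sub>R v t\<^sub>0) \<le> c / 2 * \<bar>t - t\<^sub>0\<bar>"
    by auto
  have lin_n: "\<bar>(\<gamma> t - \<gamma> t\<^sub>0) \<bullet> ?n\<bar> \<le> c / 2 * \<bar>t - t\<^sub>0\<bar>"
    and lin_h: "\<bar>snd (\<gamma> t) - snd (\<gamma> t\<^sub>0)\<bar> \<ge> c * \<bar>t - t\<^sub>0\<bar>" if "\<bar>t - t\<^sub>0\<bar> < r2" for t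
  proof -
    let ?w = "\<gamma> t - \<gamma> t\<^sub>0 - (t - t\<^sub>0) *\<^sub>R v t\<^sub>0"
    have "(\<gamma> t - \<gamma> t\<^sub>0) \<bullet> ?n = ?w \<bullet> ?n" using n(2) by (simp add: inner_diff_left inner_diff_right inner_commute)
    also have "\<bar>\<dots>\<bar> \<le> norm ?w" using Cauchy_Schwarz_ineq2[of ?w ?n] n(1) by simp
    finally show "\<bar>(\<gamma> t - \<gamma> t\<^sub>0) \<bullet> ?n\<bar> \<le> c / 2 * \<bar>t - t\<^sub>0\<bar>" using lin[OF that] by linarith
    have "\<bar>snd ?w\<bar> \<le> c / 2 * \<bar>t - t\<^sub>0\<bar>" using lin[OF that] by (metis norm_snd_le order_trans prod.collapse real_norm_def)
    moreover have "snd ?w = snd (\<gamma> t) - snd (\<gamma> t\<^sub>0) - (t - t\<^sub>0) * snd (v t\<^sub>0)" by simp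
    moreover have "\<bar>(t - t\<^sub>0) * snd (v t\<^sub>0)\<bar> = 2 * (c * \<bar>t - t\<^sub>0\<bar>)" by (simp add: abs_mult c_def)
    moreover have "0 \<le> c * \<bar>t - t\<^sub>0\<bar>" "c / 2 * \<bar>t - t\<^sub>0\<bar> = (c * \<bar>t - t\<^sub>0\<bar>) / 2" using c by auto
    ultimately show "\<bar>snd (\<gamma> t) - snd (\<gamma> t\<^sub>0)\<bar> \<ge> c * \<bar>t - t\<^sub>0\<bar>" by linarith
  qed
  \<comment> \<open>The rest of the curve stays away from \<open>\<gamma> t\<^sub>0\<close>.\<close>
  have "compact (\<gamma> ` ({0..1} - ball t\<^sub>0 r1))"
    using continuous_\<gamma> by (intro compact_continuous_image compact_diff) (auto elim: continuous_on_subset)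
  moreover have "\<gamma> t\<^sub>0 \<notin> \<gamma> ` ({0..1} - ball t\<^sub>0 r1)" using inj_\<gamma>[OF t0G] r1(1) by auto
  ultimately obtain d where d: "d > 0" "\<And>t. t \<in> {0..1} - ball t\<^sub>0 r1 \<Longrightarrow> d \<le> dist (\<gamma> t\<^sub>0) (\<gamma> t)"
    using separate_point_closed[OF compact_imp_closed] by (metis imageI)
  have "isCont \<gamma> t\<^sub>0"
    using deriv_\<gamma>[of t\<^sub>0] t0G has_vector_derivative_continuous by (auto simp: smooth_def)
  then obtain r3 where r3: "r3 > 0" "\<And>t. dist t t\<^sub>0 < r3 \<Longrightarrow> dist (\<gamma> t) (\<gamma> t\<^sub>0) < d / 2"
    using d(1) unfolding continuous_at_eps_delta by (metis half_gt_zero)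
  define r where "r = min r1 (min r2 r3)"
  define s\<^sub>0 where "s\<^sub>0 = d / 2"
  have r: "r > 0" "ball t\<^sub>0 r \<subseteq> ball t\<^sub>0 r1" "s\<^sub>0 > 0" using r1 r2 r3 d by (auto simp: r_def s\<^sub>0_def)
  have contr: "continuous_on (ball t\<^sub>0 r) \<gamma>"
    using r1(2) r(2) smooth_subset by (intro continuous_on_subset[OF continuous_\<gamma>]) (force simp: transversal_def)
  have hits: "s = 0" if t: "t \<in> ball t\<^sub>0 r" and s: "\<bar>s\<bar> < s\<^sub>0" and fr: "\<gamma> t + (s, 0) \<in> frontier \<Omega>" for t s
  proof -
    obtain t' where t': "t' \<in> {0..1}" "\<gamma> t + (s, 0) = \<gamma> t'" using fr image_\<gamma> unfolding path_image_def by (metis imageE)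
    have "dist (\<gamma> t\<^sub>0) (\<gamma> t') \<le> dist (\<gamma> t) (\<gamma> t\<^sub>0) + norm (s, 0::real)"
      unfolding t'(2)[symmetric] by (metis add_diff_cancel_left' dist_commute dist_norm dist_triangle norm_minus_commute)
    also have "\<dots> < d" using r3(2)[of t] t s by (auto simp: r_def s\<^sub>0_def dist_commute)
    finally have "t' \<in> ball t\<^sub>0 r1" using d(2)[of t'] t'(1) by auto
    moreover have "snd (\<gamma> t') = snd (\<gamma> t)" unfolding t'(2)[symmetric] by simp
    ultimately have "t' = t" using inj_onD[OF inj, of t' t] subsetD[OF r(2) t] by simp
    then show ?thesis using t'(2) by (simp add: prod_eq_iff)
  qed
  define \<Phi> where "\<Phi> = (\<lambda>(t, s). \<gamma> t + (s, 0))"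
  have cont\<Phi>: "continuous_on (ball t\<^sub>0 r \<times> X) \<Phi>" for X
    unfolding \<Phi>_def split_beta
    by (intro continuous_intros continuous_on_compose2[OF contr]) auto
  \<comment> \<open>The two-sided neighbourhood of \<open>\<gamma> t\<^sub>0\<close>; \<open>B 1\<close> and \<open>B (-1)\<close> will be its right and left halves.\<close>
  define A where "A = \<Phi> ` (ball t\<^sub>0 r \<times> {-s\<^sub>0<..<s\<^sub>0})"
  have "inj_on \<Phi> (ball t\<^sub>0 r \<times> {-s\<^sub>0<..<s\<^sub>0})"
  proof (rule inj_onI)
    fix p q assume pq: "p \<in> ball t\<^sub>0 r \<times> {-s\<^sub>0<..<s\<^sub>0}" "q \<in> ball t\<^sub>0 r \<times> {-s\<^sub>0<..<s\<^sub>0}" "\<Phi> p = \<Phi> q"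
    then have "snd (\<gamma> (fst p)) = snd (\<gamma> (fst q))" by (auto simp: \<Phi>_def split_beta prod_eq_iff)
    then have "fst p = fst q" using inj_onD[OF inj, of "fst p" "fst q"] pq subsetD[OF r(2)] by (metis mem_Times_iff)
    then show "p = q" using pq(3) by (auto simp: \<Phi>_def split_beta prod_eq_iff)
  qed
  then have openA: "open A"
    unfolding A_def by (intro invariance_of_domain cont\<Phi> open_Times) auto
  have A0: "\<gamma> t\<^sub>0 \<in> A" unfolding A_def \<Phi>_def using r by (intro image_eqI[where x = "(t\<^sub>0, 0)"]) (auto simp: zero_prod_def[symmetric])
  have AE: thesis if "p \<in> A" "\<And>t s. t \<in> ball t\<^sub>0 r \<Longrightarrow> -s\<^sub>0 < s \<Longrightarrow> s < s\<^sub>0 \<Longrightarrow> p = \<gamma> t + (s, 0) \<Longrightarrow> thesis" for p thesis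
    using that unfolding A_def \<Phi>_def image_iff by force
  define B where "B k = (\<lambda>(t, s). \<gamma> t + (k * s, 0)) ` (ball t\<^sub>0 r \<times> {0<..<s\<^sub>0})" for k
  have BI: "\<gamma> t + (k * s, 0) \<in> B k" if "t \<in> ball t\<^sub>0 r" "0 < s" "s < s\<^sub>0" for t s k
    unfolding B_def using that by (intro image_eqI[where x = "(t, s)"]) auto
  have B_side: "B k \<subseteq> \<Omega> \<or> B k \<inter> closure \<Omega> = {}" if "k = 1 \<or> k = -1" for k
  proof (rule frontier_side)
    show "connected (B k)" unfolding B_def split_beta
      by (intro connected_continuous_image connected_Times continuous_intros continuous_on_compose2[OF contr]) auto
    show "B k \<inter> frontier \<Omega> = {}"
    proof -
      have "k * s = 0" if "t \<in> ball t\<^sub>0 r" "0 < s" "s < s\<^sub>0" "\<gamma> t + (k * s, 0) \<in> frontier \<Omega>" for t s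
        using hits[of t "k * s"] that \<open>k = 1 \<or> k = -1\<close> by auto
      then show ?thesis using that by (fastforce simp: B_def)
    qed
  qed
  have inA: "p \<in> frontier \<Omega> \<or> p \<in> B 1 \<or> p \<in> B (-1)" if pA: "p \<in> A" for p
  proof -
    obtain t s where ts: "t \<in> ball t\<^sub>0 r" "-s\<^sub>0 < s" "s < s\<^sub>0" "p = \<gamma> t + (s, 0)"
      using AE[OF pA] by blast
    consider "s = 0" | "s > 0" | "s < 0" by linarith
    then show ?thesis
    proof cases
      case 1
      then have "p = \<gamma> t" using ts(4) by (simp add: zero_prod_def[symmetric])
      moreover have "t \<in> {0..1}" using ts(1) r(2) r1(2) smooth_subset[of t] by (auto simp: transversal_def subset_iff)
      ultimately show ?thesis using \<gamma>_frontier by blast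
    next
      case 2
      then show ?thesis using BI[OF ts(1), of s 1] ts by simp
    next
      case 3
      then have "p \<in> B (-1)" using BI[OF ts(1), of "- s" "- 1"] ts by simp
      then show ?thesis by simp
    qed
  qed
  have outside: "B e \<inter> closure \<Omega> = {}"
  proof -
    have "((\<lambda>s. \<gamma> t\<^sub>0 + s *\<^sub>R ?n) \<longlongrightarrow> \<gamma> t\<^sub>0 + 0 *\<^sub>R ?n) (at_right 0)" by (intro tendsto_intros)
    then have "\<forall>\<^sub>F s in at_right 0. \<gamma> t\<^sub>0 + s *\<^sub>R ?n \<in> A"
      using topological_tendstoD[OF _ openA A0] by simp
    then have "\<forall>\<^sub>F s in at_right (0::real). \<gamma> t\<^sub>0 + s *\<^sub>R ?n \<in> A \<and> \<gamma> t\<^sub>0 + s *\<^sub>R ?n \<notin> closure \<Omega> \<and> s > 0"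
      using ext eventually_at_right_less by eventually_elim auto
    then obtain s where s: "\<gamma> t\<^sub>0 + s *\<^sub>R ?n \<in> A" "\<gamma> t\<^sub>0 + s *\<^sub>R ?n \<notin> closure \<Omega>" "s > 0"
      using eventually_happens'[OF trivial_limit_at_right_real] by blast
    obtain t \<sigma> where t: "t \<in> ball t\<^sub>0 r" "-s\<^sub>0 < \<sigma>" "\<sigma> < s\<^sub>0" and eq: "\<gamma> t\<^sub>0 + s *\<^sub>R ?n = \<gamma> t + (\<sigma>, 0)"
      using AE[OF s(1)] by blast
    \<comment> \<open>A point on the normal, at distance \<open>s\<close>, is horizontally displaced from the curve by \<open>\<sigma>\<close>. The sign
      of \<open>\<sigma>\<close> is that of the first component of the normal, for the curve itself deviates in normal
      direction by at most \<open>s / 2\<close>.\<close>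
    have tr2: "\<bar>t - t\<^sub>0\<bar> < r2" using t(1) by (auto simp: r_def dist_real_def)
    have eq': "s *\<^sub>R ?n = (\<gamma> t - \<gamma> t\<^sub>0) + (\<sigma>, 0)" using eq by (simp add: algebra_simps)
    have "s = (s *\<^sub>R ?n) \<bullet> ?n" using n(1) by (simp add: dot_square_norm)
    also have "\<dots> = (\<gamma> t - \<gamma> t\<^sub>0) \<bullet> ?n + \<sigma> * fst ?n" unfolding eq' by (simp add: inner_add_left inner_prod_def algebra_simps)
    finally have s1: "s = (\<gamma> t - \<gamma> t\<^sub>0) \<bullet> ?n + \<sigma> * fst ?n" .
    have "s * snd ?n = snd (\<gamma> t) - snd (\<gamma> t\<^sub>0)" using arg_cong[OF eq', of snd] by simp
    moreover have "\<bar>snd ?n\<bar> \<le> 1" using n(1) by (metis norm_snd_le prod.collapse real_norm_def)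
    then have "\<bar>s * snd ?n\<bar> \<le> s" using s(3) by (simp add: abs_mult mult_left_le)
    ultimately have "c * \<bar>t - t\<^sub>0\<bar> \<le> s" using lin_h[OF tr2] by simp
    moreover have "(\<gamma> t - \<gamma> t\<^sub>0) \<bullet> ?n \<le> (c * \<bar>t - t\<^sub>0\<bar>) / 2" using lin_n[OF tr2] by simp
    ultimately have pos: "\<sigma> * fst ?n > 0" using s1 s(3) by linarith
    have "\<gamma> t\<^sub>0 + s *\<^sub>R ?n \<in> B e"
    proof -
      have "e * \<bar>\<sigma>\<bar> = \<sigma>" "\<sigma> \<noteq> 0" using pos by (auto simp: e_def sgn_if zero_less_mult_iff)
      then show ?thesis unfolding eq using BI[OF t(1), of "\<bar>\<sigma>\<bar>" e] t by simp
    qed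
    then have "\<not> B e \<subseteq> \<Omega>" using s(2) closure_subset by blast
    then show ?thesis using B_side[OF e] by blast
  qed
  have inside: "B (- e) \<subseteq> \<Omega>"
  proof -
    have "t\<^sub>0 \<in> {0..1}" using t0G by (simp add: smooth_def)
    then have "\<gamma> t\<^sub>0 \<in> closure \<Omega>" using \<gamma>_frontier by (auto simp: frontier_def)
    then have "A \<inter> \<Omega> \<noteq> {}" using openA A0 open_Int_closure_eq_empty by blast
    then obtain p where p: "p \<in> A" "p \<in> \<Omega>" by blast
    then have "p \<notin> frontier \<Omega>" using open_\<Omega> by (simp add: frontier_def interior_open)
    then have "p \<in> B e \<or> p \<in> B (- e)" using inA[OF p(1)] e by auto
    moreover have "p \<notin> B e" using outside p(2) closure_subset by blast
    ultimately have "B (- e) \<inter> closure \<Omega> \<noteq> {}" using p(2) closure_subset by blast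
    then show ?thesis using B_side[of "- e"] e by auto
  qed
  show ?thesis
  proof (rule that[of r s\<^sub>0])
    show "ball t\<^sub>0 r \<subseteq> transversal" using r(2) r1(2) by blast
    fix t s assume ts: "t \<in> ball t\<^sub>0 r" "0 < s" "s < s\<^sub>0"
    have "\<gamma> t + (e * s, 0) \<in> B e" "\<gamma> t + (- e * s, 0) \<in> B (- e)" using BI[OF ts] by blast+
    moreover have "\<gamma> t + (- e * s, 0) = \<gamma> t - (e * s, 0)" by (simp add: prod_eq_iff)
    ultimately show "\<gamma> t + (\<epsilon> t\<^sub>0 * s, 0) \<notin> closure \<Omega>" "\<gamma> t - (\<epsilon> t\<^sub>0 * s, 0) \<in> \<Omega>"
      using subsetD[OF inside] outside by (simp_all only: e_def[symmetric]) blast+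
  qed (use r in auto)
qed

text \<open>The normal is given pointwise, as an arbitrary function; its local rigidity makes the boundary
  integrands measurable.\<close>

lemma \<epsilon>_locally_constant:
  assumes "t\<^sub>0 \<in> transversal" shows "\<forall>\<^sub>F t in at t\<^sub>0. \<epsilon> t = \<epsilon> t\<^sub>0"
proof -
  obtain r s0 where r: "r > 0" "s0 > 0" "ball t\<^sub>0 r \<subseteq> transversal"
    and ins: "\<And>t s. t \<in> ball t\<^sub>0 r \<Longrightarrow> 0 < s \<Longrightarrow> s < s0 \<Longrightarrow> \<gamma> t - (\<epsilon> t\<^sub>0 * s, 0) \<in> \<Omega>"
    using crossing[OF assms] by metis
  have "\<epsilon> t = \<epsilon> t\<^sub>0" if t: "t \<in> ball t\<^sub>0 r" for t
  proof (rule ccontr)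
    assume ne: "\<epsilon> t \<noteq> \<epsilon> t\<^sub>0"
    have tU: "t \<in> transversal" using t r by blast
    have opp: "\<epsilon> t = - \<epsilon> t\<^sub>0"
      using ne normal_fst_nonzero[OF tU] normal_fst_nonzero[OF assms] by (auto simp: sgn_if split: if_splits)
    obtain r' s1 where r': "r' > 0" "s1 > 0"
      and outs: "\<And>t' s. t' \<in> ball t r' \<Longrightarrow> 0 < s \<Longrightarrow> s < s1 \<Longrightarrow> \<gamma> t' + (\<epsilon> t * s, 0) \<notin> closure \<Omega>"
      using crossing[OF tU] by metis
    define s where "s = min s0 s1 / 2"
    have s: "0 < s" "s < s0" "s < s1" using r r' by (auto simp: s_def)
    have "\<gamma> t + (\<epsilon> t * s, 0) = \<gamma> t - (\<epsilon> t\<^sub>0 * s, 0)" unfolding opp by (simp add: prod_eq_iff)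
    moreover have "t \<in> ball t r'" using r'(1) by simp
    ultimately show False
      using outs[OF _ s(1,3)] ins[OF t s(1,2)] subsetD[OF closure_subset, of _ \<Omega>] by metis
  qed
  then show ?thesis
    unfolding eventually_at using r(1) by (intro exI[of _ r]) (metis dist_commute mem_ball)
qed

lemma continuous_\<epsilon>: "continuous_on transversal \<epsilon>"
proof -
  have "isCont \<epsilon> t" if "t \<in> transversal" for t
    using \<epsilon>_locally_constant[OF that] by (simp add: isCont_def tendsto_eventually)
  then show ?thesis by (simp add: continuous_at_imp_continuous_on)
qed

section \<open>Integrals of horizontal derivatives\<close>


text \<open>The normal is the unit tangent turned by a right angle, up to orientation.\<close>

lemma speed_identity:
  assumes "t \<in> smooth"
  shows "fst (\<eta> (\<gamma> t)) * norm (v t) = \<epsilon> t * \<bar>snd (v t)\<bar>"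
proof -
  define a b p q where "a = fst (\<eta> (\<gamma> t))" and "b = snd (\<eta> (\<gamma> t))" and "p = fst (v t)" and "q = snd (v t)"
  have n: "norm (\<eta> (\<gamma> t)) = 1" "\<eta> (\<gamma> t) \<bullet> v t = 0" using normal[of t] assms by (auto simp: smooth_def)
  have 1: "a\<^sup>2 + b\<^sup>2 = 1" using n(1) by (simp add: norm_prod_def a_def b_def)
  have 2: "a * p = - (b * q)" using n(2) by (simp add: inner_prod_def a_def b_def p_def q_def eq_neg_iff_add_eq_0)
  have nv: "(norm (v t))\<^sup>2 = p\<^sup>2 + q\<^sup>2" by (simp add: norm_prod_def p_def q_def)
  have "(\<bar>a\<bar> * norm (v t))\<^sup>2 = (a * p)\<^sup>2 + a\<^sup>2 * q\<^sup>2" by (simp add: power_mult_distrib nv algebra_simps)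
  also have "\<dots> = (a\<^sup>2 + b\<^sup>2) * q\<^sup>2" unfolding 2 by (simp add: power_mult_distrib algebra_simps)
  also have "\<dots> = \<bar>q\<bar>\<^sup>2" using 1 by simp
  finally have "\<bar>a\<bar> * norm (v t) = \<bar>q\<bar>" by (rule power2_eq_imp_eq) auto
  then have "sgn a * \<bar>q\<bar> = sgn a * \<bar>a\<bar> * norm (v t)" by simp
  also have "sgn a * \<bar>a\<bar> = a" by (rule sgn_mult_abs)
  finally show ?thesis by (simp add: a_def q_def)
qed

lemma \<gamma>_in_closure: "t \<in> {0..1} \<Longrightarrow> \<gamma> t \<in> closure \<Omega>"
  using \<gamma>_frontier by (auto simp: frontier_def)

text \<open>Parameters with horizontal velocity do not contribute, and those in \<open>K\<close> form a null set, so the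
  boundary integral lives on the open set of transversal parameters, where its integrand is continuous
  and takes the form required by the area formula for the height of the curve.\<close>

lemma normal_component_integrand:
  assumes P: "continuous_on (closure \<Omega>) P"
  shows "set_integrable lborel {0..1} (\<lambda>t. P (\<gamma> t) * fst (\<eta> (\<gamma> t)) * norm (v t))"
    and "set_integrable lborel transversal (\<lambda>t. \<bar>snd (v t)\<bar> * (P (\<gamma> t) * \<epsilon> t))"
    and "(LINT t:{0..1}|lborel. P (\<gamma> t) * fst (\<eta> (\<gamma> t)) * norm (v t))
       = (LINT t:transversal|lborel. \<bar>snd (v t)\<bar> * (P (\<gamma> t) * \<epsilon> t))"
proof -
  let ?f = "\<lambda>t. indicat_real transversal t *\<^sub>R (\<bar>snd (v t)\<bar> * (P (\<gamma> t) * \<epsilon> t))"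
  let ?I = "\<lambda>t. indicat_real {0..1} t *\<^sub>R (P (\<gamma> t) * fst (\<eta> (\<gamma> t)) * norm (v t))"
  have UG: "transversal \<subseteq> smooth" "smooth \<subseteq> {0..1}" by (auto simp: transversal_def smooth_def)
  have contP: "continuous_on {0..1} (\<lambda>t. P (\<gamma> t))"
    using \<gamma>_in_closure by (intro continuous_on_compose2[OF P continuous_\<gamma>]) auto
  have "continuous_on transversal (\<lambda>t. \<bar>snd (v t)\<bar> * (P (\<gamma> t) * \<epsilon> t))"
    using UG by (intro continuous_intros continuous_\<epsilon> continuous_on_subset[OF contP] continuous_on_subset[OF cont_v])
      (auto simp: smooth_def)
  then have meas: "?f \<in> borel_measurable borel"
    using open_transversal by (intro borel_measurable_continuous_on_indicator) auto
  obtain B1 where B1: "\<And>t. t \<in> smooth \<Longrightarrow> norm (v t) \<le> B1"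
    using bounded_v unfolding bounded_iff smooth_def by (metis imageI)
  have "compact ((\<lambda>t. P (\<gamma> t)) ` {0..1})" using contP by (intro compact_continuous_image) auto
  then obtain B2 where B2: "\<And>t. t \<in> {0..1} \<Longrightarrow> \<bar>P (\<gamma> t)\<bar> \<le> B2"
    using compact_imp_bounded by (fastforce simp: bounded_iff)
  have bnd: "norm (?f t) \<le> \<bar>B1\<bar> * \<bar>B2\<bar>" for t
  proof (cases "t \<in> transversal")
    case True
    have "\<bar>snd (v t)\<bar> \<le> norm (v t)" by (metis norm_snd_le prod.collapse real_norm_def)
    then have "\<bar>snd (v t)\<bar> \<le> \<bar>B1\<bar>" "\<bar>P (\<gamma> t)\<bar> \<le> \<bar>B2\<bar>"
      using B1[of t] B2[of t] True UG by force+
    moreover have "\<bar>\<epsilon> t\<bar> \<le> 1" by (simp add: sgn_if)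
    ultimately show ?thesis using True
      by (simp add: abs_mult mult.assoc[symmetric] mult_mono mult_left_le)
  qed simp
  have int_f: "integrable lborel ?f"
  proof (rule integrableI_bounded_set[where A = "{0..1}" and B = "\<bar>B1\<bar> * \<bar>B2\<bar>"])
    show "AE t in lborel. t \<notin> {0..1} \<longrightarrow> ?f t = 0"
      using UG by (intro AE_I2) (auto simp: indicator_def subset_iff)
    show "AE t in lborel. t \<in> {0..1} \<longrightarrow> norm (?f t) \<le> \<bar>B1\<bar> * \<bar>B2\<bar>" using bnd by blast
  qed (use meas in auto)
  then show "set_integrable lborel transversal (\<lambda>t. \<bar>snd (v t)\<bar> * (P (\<gamma> t) * \<epsilon> t))" by (simp add: set_integrable_def)
  have eq: "?I t = ?f t" if "t \<notin> K" for t
  proof (cases "t \<in> smooth")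
    case True
    have "P (\<gamma> t) * fst (\<eta> (\<gamma> t)) * norm (v t) = \<bar>snd (v t)\<bar> * (P (\<gamma> t) * \<epsilon> t)"
      using speed_identity[OF True] by (simp add: algebra_simps)
    moreover have "snd (v t) = 0" if "t \<notin> transversal" using True that by (simp add: transversal_def)
    ultimately show ?thesis using True UG by (auto simp: indicator_def)
  next
    case False
    then have "t \<notin> {0..1}" "t \<notin> transversal" using that UG by (auto simp: smooth_def)
    then show ?thesis by simp
  qed
  have "integrable lborel ?I \<longleftrightarrow> integrable lborel ?f"
    by (rule integrable_discrete_difference[where X = K]) (use finite_K eq in \<open>auto intro: countable_finite\<close>)
  then show "set_integrable lborel {0..1} (\<lambda>t. P (\<gamma> t) * fst (\<eta> (\<gamma> t)) * norm (v t))"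
    using int_f by (simp add: set_integrable_def)
  show "(LINT t:{0..1}|lborel. P (\<gamma> t) * fst (\<eta> (\<gamma> t)) * norm (v t))
       = (LINT t:transversal|lborel. \<bar>snd (v t)\<bar> * (P (\<gamma> t) * \<epsilon> t))"
    unfolding set_lebesgue_integral_def
    by (rule integral_discrete_difference[where X = K]) (use finite_K eq in \<open>auto intro: countable_finite\<close>)
qed

text \<open>Away from these heights a horizontal line meets the curve in finitely many points and crosses
  it at each of them.\<close>

definition singular_heights :: "real set" where
  "singular_heights = (\<lambda>t. snd (\<gamma> t)) ` (K \<union> {t\<in>smooth. snd (v t) = 0})"

lemma negligible_singular_heights: "negligible singular_heights"
proof -
  have "negligible ((\<lambda>t. snd (\<gamma> t)) ` {t\<in>smooth. snd (v t) = 0})"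
  proof (rule negligible_critical_values)
    fix t assume "t \<in> {t\<in>smooth. snd (v t) = 0}"
    then show "((\<lambda>t. snd (\<gamma> t)) has_real_derivative 0) (at t within {t\<in>smooth. snd (v t) = 0})"
      using deriv_snd[of t] has_field_derivative_at_within by auto
  qed
  then show ?thesis using finite_K by (simp add: singular_heights_def image_Un negligible_Un negligible_finite)
qed

lemma regular_height:
  assumes y: "y \<notin> singular_heights" and t: "t \<in> {0..1}" "snd (\<gamma> t) = y"
  shows "t \<in> transversal"
  using assms by (auto simp: singular_heights_def transversal_def smooth_def)

text \<open>A fibre is compact, and by local injectivity of the height it has no accumulation point.\<close>

lemma finite_fibre:
  assumes y: "y \<notin> singular_heights"
  shows "finite {t\<in>transversal. snd (\<gamma> t) = y}"
proof (rule ccontr)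
  let ?T = "{t\<in>transversal. snd (\<gamma> t) = y}"
  assume inf: "infinite ?T"
  have T: "?T = {0..1} \<inter> (\<lambda>t. snd (\<gamma> t)) -` {y}"
    using regular_height[OF y] by (auto simp: transversal_def smooth_def)
  have "closed ({0..1} \<inter> (\<lambda>t. snd (\<gamma> t)) -` {y})"
    by (intro continuous_closed_preimage continuous_intros continuous_\<gamma>)
  then have "compact ?T" unfolding T by (metis bounded_Int bounded_closed_interval compact_eq_bounded_closed)
  then obtain t where t: "t \<in> ?T" "t islimpt ?T"
    using inf unfolding compact_eq_Bolzano_Weierstrass by blast
  obtain r where r: "r > 0" "inj_on (\<lambda>t. snd (\<gamma> t)) (ball t r)"
    using transversal_ball[of t] t(1) by blast
  obtain s where s: "s \<in> ?T" "s \<noteq> t" "dist s t < r" using t(2) r(1) unfolding islimpt_approachable by blast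
  then show False using inj_onD[OF r(2), of s t] t(1) r(1) by (auto simp: dist_commute)
qed

text \<open>On a horizontal line at a regular height, the frontier of the slice consists of points of the
  curve, and the weight of such a point in the fundamental theorem of calculus is the sign of the normal:
  that is what the description of the two sides of the curve says.\<close>

lemma slice_integral:
  assumes P: "continuous_on (closure \<Omega>) P" and Px: "continuous_on (closure \<Omega>) Px"
    and der: "\<And>x y. (x, y) \<in> \<Omega> \<Longrightarrow> ((\<lambda>s. P (s, y)) has_real_derivative Px (x, y)) (at x)"
    and y: "y \<notin> singular_heights"
  shows "(LINT x|lborel. indicat_real \<Omega> (x, y) *\<^sub>R Px (x, y)) = (\<Sum>t\<in>{t\<in>transversal. snd (\<gamma> t) = y}. P (\<gamma> t) * \<epsilon> t)"
proof -
  let ?T = "{t\<in>transversal. snd (\<gamma> t) = y}"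
  define S where "S = {x. (x, y) \<in> \<Omega>}"
  define Z where "Z = (\<lambda>t. fst (\<gamma> t)) ` ?T"
  have finT: "finite ?T" by (rule finite_fibre[OF y])
  have pre: "S = (\<lambda>x. (x, y)) -` \<Omega>" by (auto simp: S_def)
  have openS: "open S" unfolding pre using open_\<Omega> by (intro open_vimage continuous_intros)
  have clS: "(x, y) \<in> closure \<Omega>" if "x \<in> closure S" for x
  proof -
    have "closed ((\<lambda>x. (x, y)) -` closure \<Omega>)" by (intro closed_vimage continuous_intros closed_closure)
    then have "closure S \<subseteq> (\<lambda>x. (x, y)) -` closure \<Omega>"
      using closure_subset by (intro closure_minimal) (auto simp: S_def)
    then show ?thesis using that by auto
  qed
  have bdS: "bounded S"
  proof -
    have "S \<subseteq> fst ` \<Omega>" by (force simp: S_def)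
    then show ?thesis using bounded_fst[OF bounded_\<Omega>] bounded_subset by blast
  qed
  have frS: "frontier S \<subseteq> Z"
  proof
    fix x assume "x \<in> frontier S"
    then have "x \<in> closure S" "x \<notin> S" using openS by (auto simp: frontier_def interior_open)
    then have "(x, y) \<in> frontier \<Omega>" using clS open_\<Omega> by (auto simp: frontier_def interior_open S_def)
    then obtain t where t: "t \<in> {0..1}" "\<gamma> t = (x, y)" using image_\<gamma> unfolding path_image_def by (metis imageE)
    then have "t \<in> ?T" using regular_height[OF y t(1)] by simp
    then show "x \<in> Z" unfolding Z_def by (intro image_eqI[of _ _ t]) (auto simp: t(2))
  qed
  let ?w = "\<lambda>x. of_bool (\<forall>\<^sub>F s in at_left x. s \<in> S) - of_bool (\<forall>\<^sub>F s in at_right x. s \<in> S) :: real"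
  have "((\<lambda>x. Px (x, y)) has_integral (\<Sum>x\<in>Z. P (x, y) * ?w x)) S"
  proof (rule has_integral_open_set_finite_frontier[OF _ openS bdS frS])
    show "finite Z" using finT by (simp add: Z_def)
    show "continuous_on (closure S) (\<lambda>x. P (x, y))"
      using clS by (intro continuous_on_compose2[OF P] continuous_intros) auto
  qed (use der in \<open>auto simp: S_def\<close>)
  moreover have "(\<Sum>x\<in>Z. P (x, y) * ?w x) = (\<Sum>t\<in>?T. P (\<gamma> t) * \<epsilon> t)"
  proof -
    have "inj_on (\<lambda>t. fst (\<gamma> t)) ?T"
    proof (rule inj_onI)
      fix s t assume st: "s \<in> ?T" "t \<in> ?T" "fst (\<gamma> s) = fst (\<gamma> t)"
      then have "\<gamma> s = \<gamma> t" by (auto simp: prod_eq_iff)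
      moreover have "s \<in> smooth" "t \<in> {0..1}" using st by (auto simp: transversal_def smooth_def)
      ultimately show "s = t" using inj_\<gamma> by blast
    qed
    then have "(\<Sum>x\<in>Z. P (x, y) * ?w x) = (\<Sum>t\<in>?T. P (fst (\<gamma> t), y) * ?w (fst (\<gamma> t)))"
      unfolding Z_def by (simp add: sum.reindex)
    also have "\<dots> = (\<Sum>t\<in>?T. P (\<gamma> t) * \<epsilon> t)"
    proof (rule sum.cong[OF refl])
      fix t assume t: "t \<in> ?T"
      then have tU: "t \<in> transversal" and ht: "snd (\<gamma> t) = y" by auto
      obtain r s0 where r: "r > 0" "s0 > 0"
        and outs: "\<And>t' s. t' \<in> ball t r \<Longrightarrow> 0 < s \<Longrightarrow> s < s0 \<Longrightarrow> \<gamma> t' + (\<epsilon> t * s, 0) \<notin> closure \<Omega>"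
        and ins: "\<And>t' s. t' \<in> ball t r \<Longrightarrow> 0 < s \<Longrightarrow> s < s0 \<Longrightarrow> \<gamma> t' - (\<epsilon> t * s, 0) \<in> \<Omega>"
        using crossing[OF tU] by metis
      let ?x = "fst (\<gamma> t)"
      have gt: "\<gamma> t = (?x, y)" using ht by (simp add: prod_eq_iff)
      have tb: "t \<in> ball t r" using r by simp
      have inS: "?x - \<epsilon> t * s \<in> S" if "0 < s" "s < s0" for s
      proof -
        have "\<gamma> t - (\<epsilon> t * s, 0) = (?x - \<epsilon> t * s, y)" using ht by (simp add: prod_eq_iff)
        then show ?thesis using ins[OF tb that] by (simp only: S_def mem_Collect_eq)
      qed
      have outS: "?x + \<epsilon> t * s \<notin> S" if "0 < s" "s < s0" for s
      proof -
        have "\<gamma> t + (\<epsilon> t * s, 0) = (?x + \<epsilon> t * s, y)" using ht by (simp add: prod_eq_iff)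
        then have "(?x + \<epsilon> t * s, y) \<notin> closure \<Omega>" using outs[OF tb that] by (simp only: not_False_eq_True)
        then have "(?x + \<epsilon> t * s, y) \<notin> \<Omega>" using closure_subset by blast
        then show ?thesis by (simp only: S_def mem_Collect_eq not_False_eq_True)
      qed
      have left_point: "\<exists>\<delta>>0. \<delta> < s0 \<and> s = ?x - 1 * \<delta>" and left_point': "\<exists>\<delta>>0. \<delta> < s0 \<and> s = ?x + -1 * \<delta>"
        if "s \<in> {?x - s0<..<?x}" for s
        using that by (auto intro!: exI[of _ "?x - s"])
      have right_point: "\<exists>\<delta>>0. \<delta> < s0 \<and> s = ?x + 1 * \<delta>" and right_point': "\<exists>\<delta>>0. \<delta> < s0 \<and> s = ?x - -1 * \<delta>"
        if "s \<in> {?x<..<?x + s0}" for s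
        using that by (auto intro!: exI[of _ "s - ?x"])
      have evL: "\<forall>\<^sub>F s in at_left ?x. s \<in> {?x - s0<..<?x}" and evR: "\<forall>\<^sub>F s in at_right ?x. s \<in> {?x<..<?x + s0}"
        using eventually_at_left_real[of "?x - s0" ?x] eventually_at_right_real[of ?x "?x + s0"] r by auto
      have "?w ?x = \<epsilon> t"
      proof (cases "\<epsilon> t = 1")
        case True
        have "\<forall>\<^sub>F s in at_left ?x. s \<in> S"
          by (rule eventually_mono[OF evL]) (metis inS True left_point)
        moreover have "\<not> (\<forall>\<^sub>F s in at_right ?x. s \<in> S)"
        proof
          assume "\<forall>\<^sub>F s in at_right ?x. s \<in> S"
          then have "\<forall>\<^sub>F s in at_right ?x. False"
            using evR by (rule eventually_elim2) (metis outS True right_point)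
          then show False by simp
        qed
        ultimately show ?thesis using True by simp
      next
        case False
        then have m: "\<epsilon> t = -1" using normal_fst_nonzero[OF tU] by (auto simp: sgn_if split: if_splits)
        have "\<forall>\<^sub>F s in at_right ?x. s \<in> S"
          by (rule eventually_mono[OF evR]) (metis inS m right_point')
        moreover have "\<not> (\<forall>\<^sub>F s in at_left ?x. s \<in> S)"
        proof
          assume "\<forall>\<^sub>F s in at_left ?x. s \<in> S"
          then have "\<forall>\<^sub>F s in at_left ?x. False"
            using evL by (rule eventually_elim2) (metis outS m left_point')
          then show False by simp
        qed
        ultimately show ?thesis using m by simp
      qed
      then show "P (?x, y) * ?w ?x = P (\<gamma> t) * \<epsilon> t" by (simp only: gt[symmetric])
    qed
    finally show ?thesis .
  qed
  moreover have "set_integrable lborel S (\<lambda>x. Px (x, y))"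
  proof -
    have "continuous_on (closure S) (\<lambda>x. Px (x, y))"
      using clS by (intro continuous_on_compose2[OF Px] continuous_intros) auto
    moreover have "compact (closure S)" using bdS by simp
    ultimately have "set_integrable lborel (closure S) (\<lambda>x. Px (x, y))"
      unfolding set_integrable_def by (intro borel_integrable_compact)
    then show ?thesis by (rule set_integrable_subset[OF _ _ closure_subset]) (use openS in auto)
  qed
  then have "(LINT x:S|lborel. Px (x, y)) = integral S (\<lambda>x. Px (x, y))"
    by (rule set_borel_integral_eq_integral)
  moreover have "indicat_real \<Omega> (x, y) = indicat_real S x" for x by (simp add: indicator_def S_def)
  ultimately show ?thesis by (simp add: set_lebesgue_integral_def integral_unique)
qed

text \<open>Half of the divergence theorem. Integrating over horizontal slices turns the left-hand side into
  an integral over the height of sums over fibres; by the area formula for the height of the curve this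
  is the boundary integral. Corners, cusps included, enter only through the null set of singular
  heights.\<close>

theorem integral_x_derivative:
  assumes P: "continuous_on (closure \<Omega>) P" and Px: "continuous_on (closure \<Omega>) Px"
    and der: "\<And>x y. (x, y) \<in> \<Omega> \<Longrightarrow> ((\<lambda>s. P (s, y)) has_real_derivative Px (x, y)) (at x)"
  shows "(LINT p:\<Omega>|lborel. Px p) = (LINT t:{0..1}|lborel. P (\<gamma> t) * fst (\<eta> (\<gamma> t)) * norm (v t))"
proof -
  let ?\<Sigma> = "\<lambda>y. \<Sum>t\<in>{t\<in>transversal. snd (\<gamma> t) = y}. P (\<gamma> t) * \<epsilon> t"
  let ?F = "\<lambda>y. LINT x|lborel. indicat_real \<Omega> (x, y) *\<^sub>R Px (x, y)"
  have compact_cl: "compact (closure \<Omega>)" using bounded_\<Omega> by simp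
  have "set_integrable lborel (closure \<Omega>) Px"
    unfolding set_integrable_def by (rule borel_integrable_compact[OF compact_cl Px])
  then have "set_integrable lborel \<Omega> Px"
    by (rule set_integrable_subset[OF _ _ closure_subset]) (use open_\<Omega> in auto)
  then have int: "integrable (lborel \<Otimes>\<^sub>M lborel) (\<lambda>(x, y). indicat_real \<Omega> (x, y) *\<^sub>R Px (x, y))"
    by (simp add: lborel_prod set_integrable_def case_prod_beta')
  have "(LINT p:\<Omega>|lborel. Px p) = (LINT y|lborel. ?F y)"
    using lborel_pair.integral_snd[OF int] by (simp add: lborel_prod set_lebesgue_integral_def case_prod_beta')
  also have "\<dots> = (LINT y|lebesgue. ?F y)"
    by (rule integral_completion[symmetric])
       (use borel_measurable_integrable[OF lborel_pair.integrable_snd[OF int]] in simp)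
  also have "\<dots> = (LINT y|lebesgue. ?\<Sigma> y)"
  proof -
    have m: "?F \<in> borel_measurable lebesgue"
      using borel_measurable_integrable[OF lborel_pair.integrable_snd[OF int]] by (simp add: measurable_completion)
    have ae: "AE y in lebesgue. ?F y = ?\<Sigma> y"
      using negligible_singular_heights slice_integral[OF P Px der]
      by (intro AE_I'[where N = singular_heights]) (auto simp: negligible_iff_null_sets)
    show ?thesis by (rule integral_cong_AE[OF m borel_measurable_AE[OF m ae] ae])
  qed
  also have "\<dots> = (LINT t:transversal|lebesgue. \<bar>snd (v t)\<bar> * (P (\<gamma> t) * \<epsilon> t))"
  proof (rule lebesgue_integral_eq_sum_over_fibres[OF open_transversal, symmetric])
    show "((\<lambda>t. snd (\<gamma> t)) has_real_derivative snd (v t)) (at t)" "snd (v t) \<noteq> 0" if "t \<in> transversal" for t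
      using that deriv_snd by (auto simp: transversal_def)
    show "continuous_on transversal (\<lambda>t. snd (v t))"
      by (intro continuous_intros continuous_on_subset[OF cont_v]) (auto simp: transversal_def smooth_def)
    show "set_integrable lebesgue transversal (\<lambda>t. \<bar>snd (v t)\<bar> * (P (\<gamma> t) * \<epsilon> t))"
      using normal_component_integrand(2)[OF P] unfolding set_integrable_def by (rule integrable_completion[THEN iffD2, rotated]) (use normal_component_integrand(2)[OF P] in \<open>auto simp: set_integrable_def\<close>)
    show "negligible {y. infinite {t\<in>transversal. snd (\<gamma> t) = y}}"
      by (rule negligible_subset[OF negligible_singular_heights]) (use finite_fibre in blast)
  qed
  also have "\<dots> = (LINT t:transversal|lborel. \<bar>snd (v t)\<bar> * (P (\<gamma> t) * \<epsilon> t))"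
    unfolding set_lebesgue_integral_def
    using normal_component_integrand(2)[OF P]
    by (intro integral_completion) (auto simp: set_integrable_def)
  also have "\<dots> = (LINT t:{0..1}|lborel. P (\<gamma> t) * fst (\<eta> (\<gamma> t)) * norm (v t))"
    by (rule normal_component_integrand(3)[OF P, symmetric])
  finally show ?thesis .
qed

end

section \<open>The divergence theorem and tangential derivatives\<close>

lemma bounded_linear_swap: "bounded_linear (prod.swap :: real \<times> real \<Rightarrow> real \<times> real)"
proof -
  have "bounded_linear (\<lambda>p::real \<times> real. (snd p, fst p))"
    by (intro bounded_linear_Pair bounded_linear_fst bounded_linear_snd)
  then show ?thesis by (simp add: prod.swap_def[abs_def])
qed

lemma closure_swap: "closure (prod.swap ` S) = prod.swap ` closure S" for S :: "(real \<times> real) set"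
  by (rule closure_injective_linear_image[symmetric])
     (auto intro: bounded_linear.linear[OF bounded_linear_swap])

lemma open_swap: "open (prod.swap ` S)" if "open S" for S :: "(real \<times> real) set"
proof -
  have "prod.swap ` S = prod.swap -` S" by force
  moreover have "open (prod.swap -` S)"
    by (intro open_vimage that linear_continuous_on bounded_linear_swap)
  ultimately show ?thesis by simp
qed

lemma integral_swap:
  fixes f :: "real \<times> real \<Rightarrow> real"
  assumes "f \<in> borel_measurable borel"
  shows "(LINT p|lborel. f (prod.swap p)) = (LINT p|lborel. f p)"
proof -
  have "integral\<^sup>L (lborel \<Otimes>\<^sub>M lborel) (\<lambda>p. f (prod.swap p)) = integral\<^sup>L (lborel \<Otimes>\<^sub>M lborel) f"
    using lborel_pair.integral_product_swap[of f] assms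
    by (simp add: lborel_prod case_prod_beta' prod.swap_def)
  then show ?thesis by (simp add: lborel_prod)
qed

context parametrised_boundary
begin

text \<open>The half of the divergence theorem for vertical derivatives follows from the one for horizontal
  derivatives by exchanging the coordinates.\<close>

lemma swapped:
  "parametrised_boundary (prod.swap ` \<Omega>) (prod.swap \<circ> \<gamma>) (prod.swap \<circ> v) (prod.swap \<circ> \<eta> \<circ> prod.swap) K"
proof
  show "open (prod.swap ` \<Omega>)" by (rule open_swap[OF open_\<Omega>])
  show "bounded (prod.swap ` \<Omega>)" by (rule bounded_linear_image[OF bounded_\<Omega> bounded_linear_swap])
  show "simple_path (prod.swap \<circ> \<gamma>)"
    using simple_\<gamma> by (subst simple_path_linear_image_eq) (auto intro: bounded_linear.linear[OF bounded_linear_swap])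
  show "path_image (prod.swap \<circ> \<gamma>) = frontier (prod.swap ` \<Omega>)"
    using image_\<gamma> open_\<Omega> open_swap[OF open_\<Omega>]
    by (simp add: path_image_compose frontier_def interior_open closure_swap image_set_diff)
  show "((prod.swap \<circ> \<gamma>) has_vector_derivative (prod.swap \<circ> v) t) (at t)" if "t \<in> {0..1} - K" for t
    using bounded_linear.has_vector_derivative[OF bounded_linear_swap deriv_\<gamma>[OF that]] by (simp add: o_def)
  show "(prod.swap \<circ> v) t \<noteq> 0" if "t \<in> {0..1} - K" for t
    using v_nonzero[OF that] by (simp add: prod_eq_iff prod.swap_def) blast
  show "continuous_on ({0..1} - K) (prod.swap \<circ> v)"
    by (intro continuous_on_compose cont_v linear_continuous_on bounded_linear_swap)
  show "bounded ((prod.swap \<circ> v) ` ({0..1} - K))"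
    unfolding image_comp[symmetric] by (rule bounded_linear_image[OF bounded_v bounded_linear_swap])
  show "norm ((prod.swap \<circ> \<eta> \<circ> prod.swap) ((prod.swap \<circ> \<gamma>) t)) = 1 \<and>
         (prod.swap \<circ> \<eta> \<circ> prod.swap) ((prod.swap \<circ> \<gamma>) t) \<bullet> (prod.swap \<circ> v) t = 0 \<and>
         (\<forall>\<^sub>F s in at_right 0. (prod.swap \<circ> \<gamma>) t + s *\<^sub>R (prod.swap \<circ> \<eta> \<circ> prod.swap) ((prod.swap \<circ> \<gamma>) t)
            \<notin> closure (prod.swap ` \<Omega>))" if "t \<in> {0..1} - K" for t
  proof -
    note n = normal[OF that]
    have 1: "(prod.swap \<circ> \<gamma>) t + s *\<^sub>R prod.swap (\<eta> (\<gamma> t)) = prod.swap (\<gamma> t + s *\<^sub>R \<eta> (\<gamma> t))" for s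
      by (simp add: prod_eq_iff)
    have 2: "prod.swap p \<in> prod.swap ` closure \<Omega> \<longleftrightarrow> p \<in> closure \<Omega>" for p
      by (auto dest: injD[OF inj_swap])
    have "norm (prod.swap (\<eta> (\<gamma> t))) = norm (\<eta> (\<gamma> t))" "prod.swap (\<eta> (\<gamma> t)) \<bullet> prod.swap (v t) = \<eta> (\<gamma> t) \<bullet> v t"
      by (simp_all add: norm_prod_def inner_prod_def add.commute)
    then show ?thesis using n by (simp add: closure_swap 2 1[unfolded o_def])
  qed
qed (use finite_K ends_K in auto)

theorem integral_y_derivative:
  assumes P: "continuous_on (closure \<Omega>) P" and Py: "continuous_on (closure \<Omega>) Py"
    and der: "\<And>x y. (x, y) \<in> \<Omega> \<Longrightarrow> ((\<lambda>s. P (x, s)) has_real_derivative Py (x, y)) (at y)"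
  shows "(LINT p:\<Omega>|lborel. Py p) = (LINT t:{0..1}|lborel. P (\<gamma> t) * snd (\<eta> (\<gamma> t)) * norm (v t))"
    and "set_integrable lborel {0..1} (\<lambda>t. P (\<gamma> t) * snd (\<eta> (\<gamma> t)) * norm (v t))"
proof -
  interpret sw: parametrised_boundary "prod.swap ` \<Omega>" "prod.swap \<circ> \<gamma>" "prod.swap \<circ> v" "prod.swap \<circ> \<eta> \<circ> prod.swap" K
    by (rule swapped)
  have cont: "continuous_on (closure (prod.swap ` \<Omega>)) (f \<circ> prod.swap)" if "continuous_on (closure \<Omega>) f" for f :: "_ \<Rightarrow> real"
    unfolding closure_swap
    by (rule continuous_on_compose[OF linear_continuous_on[OF bounded_linear_swap]]) (use that in \<open>simp add: image_image\<close>)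
  have norm_sw: "norm (prod.swap w) = norm w" for w :: "real \<times> real" by (simp add: norm_prod_def add.commute)
  let ?f = "\<lambda>p. indicat_real \<Omega> p *\<^sub>R Py p"
  have "continuous_on \<Omega> Py" by (rule continuous_on_subset[OF Py closure_subset])
  then have "?f \<in> borel_measurable borel" using open_\<Omega> by (intro borel_measurable_continuous_on_indicator) auto
  from integral_swap[OF this]
  have "(LINT p:\<Omega>|lborel. Py p) = (LINT p|lborel. indicat_real \<Omega> (prod.swap p) *\<^sub>R Py (prod.swap p))"
    by (simp add: set_lebesgue_integral_def)
  also have "\<dots> = (LINT p:prod.swap ` \<Omega>|lborel. (Py \<circ> prod.swap) p)"
  proof -
    have "p \<in> prod.swap ` \<Omega> \<longleftrightarrow> prod.swap p \<in> \<Omega>" for p :: "real \<times> real" by force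
    then show ?thesis by (simp add: set_lebesgue_integral_def indicator_def)
  qed
  also have "\<dots> = (LINT t:{0..1}|lborel. (P \<circ> prod.swap) ((prod.swap \<circ> \<gamma>) t) *
      fst ((prod.swap \<circ> \<eta> \<circ> prod.swap) ((prod.swap \<circ> \<gamma>) t)) * norm ((prod.swap \<circ> v) t))"
    by (rule sw.integral_x_derivative[OF cont[OF P] cont[OF Py]]) (use der in auto)
  finally show "(LINT p:\<Omega>|lborel. Py p) = (LINT t:{0..1}|lborel. P (\<gamma> t) * snd (\<eta> (\<gamma> t)) * norm (v t))"
    by (simp add: norm_sw)
  show "set_integrable lborel {0..1} (\<lambda>t. P (\<gamma> t) * snd (\<eta> (\<gamma> t)) * norm (v t))"
    using sw.normal_component_integrand(1)[OF cont[OF P]] by (simp add: norm_sw)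
qed

lemma set_integrable_continuous_closure:
  fixes g :: "real \<times> real \<Rightarrow> real"
  assumes "continuous_on (closure \<Omega>) g" shows "set_integrable lborel \<Omega> g"
proof -
  have "set_integrable lborel (closure \<Omega>) g"
    unfolding set_integrable_def by (rule borel_integrable_compact[OF _ assms]) (use bounded_\<Omega> in simp)
  then show ?thesis by (rule set_integrable_subset[OF _ _ closure_subset]) (use open_\<Omega> in auto)
qed

theorem divergence_theorem:
  assumes P: "continuous_on (closure \<Omega>) P" and Px: "continuous_on (closure \<Omega>) Px"
    and Q: "continuous_on (closure \<Omega>) Q" and Qy: "continuous_on (closure \<Omega>) Qy"
    and derP: "\<And>x y. (x, y) \<in> \<Omega> \<Longrightarrow> ((\<lambda>s. P (s, y)) has_real_derivative Px (x, y)) (at x)"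
    and derQ: "\<And>x y. (x, y) \<in> \<Omega> \<Longrightarrow> ((\<lambda>s. Q (x, s)) has_real_derivative Qy (x, y)) (at y)"
  shows "(LINT p:\<Omega>|lborel. Px p + Qy p) = (LINT t:{0..1}|lborel. ((P (\<gamma> t), Q (\<gamma> t)) \<bullet> \<eta> (\<gamma> t)) * norm (v t))"
proof -
  have "(LINT p:\<Omega>|lborel. Px p + Qy p) = (LINT p:\<Omega>|lborel. Px p) + (LINT p:\<Omega>|lborel. Qy p)"
    by (rule set_integral_add(2)) (use set_integrable_continuous_closure Px Qy in auto)
  also have "\<dots> = (LINT t:{0..1}|lborel. P (\<gamma> t) * fst (\<eta> (\<gamma> t)) * norm (v t))
      + (LINT t:{0..1}|lborel. Q (\<gamma> t) * snd (\<eta> (\<gamma> t)) * norm (v t))"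
    using integral_x_derivative[OF P Px derP] integral_y_derivative(1)[OF Q Qy derQ] by simp
  also have "\<dots> = (LINT t:{0..1}|lborel. P (\<gamma> t) * fst (\<eta> (\<gamma> t)) * norm (v t) + Q (\<gamma> t) * snd (\<eta> (\<gamma> t)) * norm (v t))"
    by (rule set_integral_add(2)[symmetric, OF normal_component_integrand(1)[OF P] integral_y_derivative(2)[OF Q Qy derQ]])
  finally show ?thesis by (simp add: inner_prod_def algebra_simps)
qed

text \<open>The derivatives of \<open>u\<close> exist only inside the domain, so the boundary curve is shifted slightly
  into it. If the tangential derivative at \<open>t\<^sub>0\<close> were positive, it would be bounded below near \<open>t\<^sub>0\<close> on all
  shifted curves; then \<open>u\<close> would increase along them by a fixed amount, and by continuity also along the
  boundary, where it vanishes.\<close>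

lemma tangential_derivative_nonpos:
  assumes t0: "t\<^sub>0 \<in> transversal" and u: "continuous_on (closure \<Omega>) u"
    and ux: "continuous_on (closure \<Omega>) ux" and uy: "continuous_on (closure \<Omega>) uy"
    and der: "\<And>p. p \<in> \<Omega> \<Longrightarrow> (u has_derivative (\<lambda>q. ux p * fst q + uy p * snd q)) (at p)"
    and const: "\<forall>\<^sub>F t in nhds t\<^sub>0. u (\<gamma> t) = 0"
  shows "ux (\<gamma> t\<^sub>0) * fst (v t\<^sub>0) + uy (\<gamma> t\<^sub>0) * snd (v t\<^sub>0) \<le> 0"
proof (rule ccontr)
  define e where "e = \<epsilon> t\<^sub>0"
  obtain r s0 where r: "r > 0" "s0 > 0" "ball t\<^sub>0 r \<subseteq> transversal"
    and ins: "\<And>t s. t \<in> ball t\<^sub>0 r \<Longrightarrow> 0 < s \<Longrightarrow> s < s0 \<Longrightarrow> \<gamma> t - (e * s, 0) \<in> \<Omega>"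
    using crossing[OF t0] unfolding e_def by metis
  define q where "q = (\<lambda>(t, s). \<gamma> t - (e * s, 0))"
  define L where "L z = ux (q z) * fst (v (fst z)) + uy (q z) * snd (v (fst z))" for z
  let ?D = "ball t\<^sub>0 r \<times> {0..<s0}"
  assume "\<not> ux (\<gamma> t\<^sub>0) * fst (v t\<^sub>0) + uy (\<gamma> t\<^sub>0) * snd (v t\<^sub>0) \<le> 0"
  then have L0: "L (t\<^sub>0, 0) > 0" by (simp add: L_def q_def zero_prod_def[symmetric])
  have rG: "t \<in> smooth" "t \<in> {0..1}" if "t \<in> ball t\<^sub>0 r" for t using that r(3) by (auto simp: transversal_def smooth_def)
  have q_cl: "q (t, s) \<in> closure \<Omega>" if "t \<in> ball t\<^sub>0 r" "0 \<le> s" "s < s0" for t s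
  proof (cases "s = 0")
    case True
    then show ?thesis using \<gamma>_in_closure[OF rG(2)[OF that(1)]] by (simp add: q_def zero_prod_def[symmetric])
  next
    case False
    then show ?thesis using ins[of t s] that closure_subset by (auto simp: q_def)
  qed
  have cont_q: "continuous_on ?D q"
    unfolding q_def split_beta
    by (intro continuous_intros continuous_on_compose2[OF continuous_\<gamma>]) (use rG in auto)
  have qD: "q ` ?D \<subseteq> closure \<Omega>" using q_cl by auto
  have cont_u: "continuous_on ?D (\<lambda>z. u (q z))" by (rule continuous_on_compose2[OF u cont_q qD])
  have cont_vD: "continuous_on ?D (\<lambda>z. v (fst z))"
    by (intro continuous_on_compose2[OF cont_v] continuous_intros) (use rG in \<open>auto simp: smooth_def\<close>)
  have "continuous_on ?D L"
    unfolding L_def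
    by (intro continuous_intros continuous_on_compose2[OF ux cont_q qD] continuous_on_compose2[OF uy cont_q qD] cont_vD)
  then obtain d where d: "d > 0" "\<And>z. z \<in> ?D \<Longrightarrow> dist z (t\<^sub>0, 0) < d \<Longrightarrow> dist (L z) (L (t\<^sub>0, 0)) < L (t\<^sub>0, 0) / 2"
    unfolding continuous_on_iff using r L0 by (metis SigmaI atLeastLessThan_iff centre_in_ball half_gt_zero order_refl)
  obtain r' where r': "r' > 0" "\<And>t. dist t t\<^sub>0 < r' \<Longrightarrow> u (\<gamma> t) = 0"
    using const unfolding eventually_nhds_metric by blast
  define \<delta> where "\<delta> = min (d / 2) (min r r' / 2)"
  define s1 where "s1 = min (d / 2) (s0 / 2)"
  have \<delta>: "0 < \<delta>" "\<delta> \<le> d / 2" "\<delta> < r" "\<delta> < r'" and s1: "0 < s1" "s1 \<le> d / 2" "s1 < s0"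
    using d r r' by (auto simp: \<delta>_def s1_def)
  define c where "c = L (t\<^sub>0, 0) / 2"
  have bd: "L (t, s) \<ge> c" if "t\<^sub>0 \<le> t" "t \<le> t\<^sub>0 + \<delta>" "0 < s" "s < s1" for t s
  proof -
    have "dist (t, s) (t\<^sub>0, 0) \<le> \<bar>t - t\<^sub>0\<bar> + \<bar>s\<bar>"
      using norm_Pair_le[of "t - t\<^sub>0" s] by (simp add: dist_norm)
    also have "\<dots> < d" using that \<delta> s1 by auto
    finally have "dist (L (t, s)) (L (t\<^sub>0, 0)) < c"
      using d(2)[of "(t, s)"] that \<delta> s1 by (auto simp: dist_real_def c_def)
    then show ?thesis unfolding dist_real_def c_def by linarith
  qed
  let ?g = "\<lambda>s. u (q (t\<^sub>0 + \<delta>, s)) - u (q (t\<^sub>0, s))"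
  have mvt: "?g s \<ge> c * \<delta>" if s: "s \<in> {0<..<s1}" for s
  proof -
    have "((\<lambda>t. u (q (t, s))) has_real_derivative L (t, s)) (at t)" if t: "t\<^sub>0 \<le> t" "t \<le> t\<^sub>0 + \<delta>" for t
    proof -
      have tb: "t \<in> ball t\<^sub>0 r" using t \<delta> by (auto simp: dist_real_def)
      have "q (t, s) \<in> \<Omega>" using ins[OF tb, of s] s s1 by (simp add: q_def)
      note D = der[OF this]
      have "((\<lambda>t. q (t, s)) has_vector_derivative v t) (at t)"
        unfolding q_def split_beta fst_conv snd_conv
        using has_vector_derivative_diff[OF deriv_\<gamma>[of t] has_vector_derivative_const] rG[OF tb]
        by (simp add: smooth_def)
      from diff_chain_at[OF this[unfolded has_vector_derivative_def] D]
      have "((\<lambda>t. u (q (t, s))) has_derivative (\<lambda>h. h * L (t, s))) (at t)"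
        by (simp add: o_def L_def algebra_simps)
      then show ?thesis by (simp add: has_field_derivative_def mult_commute_abs)
    qed
    from MVT2[of t\<^sub>0 "t\<^sub>0 + \<delta>", OF _ this]
    obtain z where "t\<^sub>0 < z" "z < t\<^sub>0 + \<delta>" "?g s = \<delta> * L (z, s)" using \<delta>(1) by auto
    then show ?thesis using bd[of z s] s \<delta>(1) by (simp add: mult.commute)
  qed
  have cl: "closure {0<..<s1} = {0..s1}" using s1 by simp
  have "continuous_on {0..s1} (\<lambda>s. u (q (t, s)))" if "t \<in> ball t\<^sub>0 r" for t
    by (rule continuous_on_compose2[OF cont_u]) (use that s1 in \<open>auto intro!: continuous_intros\<close>)
  then have "continuous_on (closure {0<..<s1}) ?g"
    unfolding cl using \<delta> r by (intro continuous_intros) (auto simp: dist_real_def)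
  then have "?g 0 \<ge> c * \<delta>" by (rule continuous_ge_on_closure) (use mvt s1 in auto)
  moreover have "?g 0 = 0" using r'(2)[of "t\<^sub>0 + \<delta>"] r'(2)[of t\<^sub>0] \<delta> r'(1)
    by (simp add: q_def zero_prod_def[symmetric] dist_real_def)
  moreover have "c * \<delta> > 0" using L0 \<delta>(1) by (simp add: c_def)
  ultimately show False by simp
qed

lemma tangential_derivative_zero:
  assumes "t\<^sub>0 \<in> transversal" and u: "continuous_on (closure \<Omega>) u"
    and ux: "continuous_on (closure \<Omega>) ux" and uy: "continuous_on (closure \<Omega>) uy"
    and der: "\<And>p. p \<in> \<Omega> \<Longrightarrow> (u has_derivative (\<lambda>q. ux p * fst q + uy p * snd q)) (at p)"
    and const: "\<forall>\<^sub>F t in nhds t\<^sub>0. u (\<gamma> t) = 0"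
  shows "ux (\<gamma> t\<^sub>0) * fst (v t\<^sub>0) + uy (\<gamma> t\<^sub>0) * snd (v t\<^sub>0) = 0"
proof -
  have "- ux (\<gamma> t\<^sub>0) * fst (v t\<^sub>0) + - uy (\<gamma> t\<^sub>0) * snd (v t\<^sub>0) \<le> 0"
  proof (rule tangential_derivative_nonpos[where u = "\<lambda>p. - u p" and ux = "\<lambda>p. - ux p" and uy = "\<lambda>p. - uy p"])
    show "((\<lambda>p. - u p) has_derivative (\<lambda>q. - ux p * fst q + - uy p * snd q)) (at p)" if "p \<in> \<Omega>" for p
      using has_derivative_minus[OF der[OF that]] by (simp add: algebra_simps)
  qed (use assms in \<open>auto intro!: continuous_intros\<close>)
  then show ?thesis using tangential_derivative_nonpos[OF assms] by simp
qed

end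

text \<open>Inside a piece the one-sided derivative is the derivative, and the continuous extension to the
  closed piece bounds it.\<close>

lemma piecewise_C1_regular_corners:
  assumes "piecewise_C1_regular \<gamma>"
  obtains K where "finite K" "0 \<in> K" "1 \<in> K"
    "\<And>t. t \<in> {0..1} - K \<Longrightarrow> (\<gamma> has_vector_derivative vector_derivative \<gamma> (at t)) (at t)"
    "\<And>t. t \<in> {0..1} - K \<Longrightarrow> vector_derivative \<gamma> (at t) \<noteq> 0"
    "continuous_on ({0..1} - K) (\<lambda>t. vector_derivative \<gamma> (at t))"
    "bounded ((\<lambda>t. vector_derivative \<gamma> (at t)) ` ({0..1} - K))"
proof -
  obtain n :: nat and \<tau> where \<tau>: "\<tau> 0 = 0" "\<tau> n = 1"
    and reg: "\<And>i. i < n \<Longrightarrow> \<tau> i < \<tau> (Suc i) \<and> C1_regular_on \<gamma> (\<tau> i) (\<tau> (Suc i))"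
    using assms unfolding piecewise_C1_regular_def by blast
  define K where "K = \<tau> ` {..n}"
  let ?v = "\<lambda>t. vector_derivative \<gamma> (at t)"
  obtain g where g: "\<And>i. i < n \<Longrightarrow> continuous_on {\<tau> i..\<tau> (Suc i)} (g i)"
    and gd: "\<And>i t. i < n \<Longrightarrow> t \<in> {\<tau> i..\<tau> (Suc i)} \<Longrightarrow>
      (\<gamma> has_vector_derivative g i t) (at t within {\<tau> i..\<tau> (Suc i)}) \<and> g i t \<noteq> 0"
    using reg unfolding C1_regular_on_def by metis
  have piece: "\<exists>i<n. t \<in> {\<tau> i<..<\<tau> (Suc i)}" if t: "t \<in> {0..1} - K" for t
  proof -
    define i where "i = Max {i. i \<le> n \<and> \<tau> i \<le> t}"
    have fin: "finite {i. i \<le> n \<and> \<tau> i \<le> t}" "{i. i \<le> n \<and> \<tau> i \<le> t} \<noteq> {}" using t \<tau> by auto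
    have i: "i \<le> n" "\<tau> i \<le> t" using Max_in[OF fin] by (auto simp: i_def)
    have neq: "\<tau> j \<noteq> t" if "j \<le> n" for j using t that by (auto simp: K_def)
    have "i < n" using i neq[of n] \<tau>(2) t by (cases "i = n") auto
    moreover have "\<not> \<tau> (Suc i) \<le> t"
    proof
      assume "\<tau> (Suc i) \<le> t"
      then have "Suc i \<in> {i. i \<le> n \<and> \<tau> i \<le> t}" using \<open>i < n\<close> by simp
      then have "Suc i \<le> i" unfolding i_def using fin(1) by (rule Max_ge[rotated])
      then show False by simp
    qed
    ultimately show ?thesis using i neq[of i] by (intro exI[of _ i]) auto
  qed
  have der: "(\<gamma> has_vector_derivative g i t) (at t)" if "i < n" "t \<in> {\<tau> i<..<\<tau> (Suc i)}" for i t
    using gd[of i t] that at_within_Icc_at[of "\<tau> i" t "\<tau> (Suc i)"] by auto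
  have v_g: "?v t = g i t" if "i < n" "t \<in> {\<tau> i<..<\<tau> (Suc i)}" for i t
    using der[OF that] by (rule vector_derivative_at)
  show ?thesis
  proof (rule that[of K])
    show "finite K" "0 \<in> K" "1 \<in> K" using \<tau> by (auto simp: K_def intro: image_eqI[of _ _ 0] image_eqI[of _ _ n])
    show "(\<gamma> has_vector_derivative ?v t) (at t)" "?v t \<noteq> 0" if t: "t \<in> {0..1} - K" for t
    proof -
      obtain i where i: "i < n" "t \<in> {\<tau> i<..<\<tau> (Suc i)}" using piece[OF t] by blast
      then show "(\<gamma> has_vector_derivative ?v t) (at t)" "?v t \<noteq> 0"
        using der[OF i] v_g[OF i] gd[of i t] by auto
    qed
    have "isCont ?v t" if t: "t \<in> {0..1} - K" for t
    proof -
      obtain i where i: "i < n" "t \<in> {\<tau> i<..<\<tau> (Suc i)}" using piece[OF t] by blast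
      have "continuous_on {\<tau> i<..<\<tau> (Suc i)} (g i)" by (rule continuous_on_subset[OF g[OF i(1)]]) auto
      then have "continuous_on {\<tau> i<..<\<tau> (Suc i)} ?v" using v_g[OF i(1)] by (subst continuous_on_cong[OF refl]) auto
      then show ?thesis using i(2) by (simp add: continuous_on_eq_continuous_at)
    qed
    then show "continuous_on ({0..1} - K) ?v" by (simp add: continuous_at_imp_continuous_on)
    have "?v ` ({0..1} - K) \<subseteq> (\<Union>i\<in>{..<n}. g i ` {\<tau> i..\<tau> (Suc i)})"
    proof
      fix w assume "w \<in> ?v ` ({0..1} - K)"
      then obtain t where t: "t \<in> {0..1} - K" "w = ?v t" by blast
      obtain i where i: "i < n" "t \<in> {\<tau> i<..<\<tau> (Suc i)}" using piece[OF t(1)] by blast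
      then have "w \<in> g i ` {\<tau> i..\<tau> (Suc i)}" using v_g[OF i] t(2) by auto
      then show "w \<in> (\<Union>i\<in>{..<n}. g i ` {\<tau> i..\<tau> (Suc i)})" using i(1) by blast
    qed
    moreover have "bounded (\<Union>i\<in>{..<n}. g i ` {\<tau> i..\<tau> (Suc i)})"
      by (intro bounded_UN ballI compact_imp_bounded compact_continuous_image g) auto
    ultimately show "bounded (?v ` ({0..1} - K))" using bounded_subset by blast
  qed
qed

lemma parametrised_boundary_exists:
  assumes "open \<Omega>" "bounded \<Omega>" "piecewise_C1_boundary \<Omega> \<gamma>" "exterior_unit_normal \<Omega> \<gamma> \<eta>"
  obtains K where "parametrised_boundary \<Omega> \<gamma> (\<lambda>t. vector_derivative \<gamma> (at t)) \<eta> K"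
proof -
  obtain K where K: "finite K" "0 \<in> K" "1 \<in> K"
    "\<And>t. t \<in> {0..1} - K \<Longrightarrow> (\<gamma> has_vector_derivative vector_derivative \<gamma> (at t)) (at t)"
    "\<And>t. t \<in> {0..1} - K \<Longrightarrow> vector_derivative \<gamma> (at t) \<noteq> 0"
    "continuous_on ({0..1} - K) (\<lambda>t. vector_derivative \<gamma> (at t))"
    "bounded ((\<lambda>t. vector_derivative \<gamma> (at t)) ` ({0..1} - K))"
    using piecewise_C1_regular_corners[of \<gamma>] assms(3) unfolding piecewise_C1_boundary_def by metis
  have "parametrised_boundary \<Omega> \<gamma> (\<lambda>t. vector_derivative \<gamma> (at t)) \<eta> K"
  proof
    fix t assume t: "t \<in> {0..1} - K"
    then have "t \<in> {0<..<1}" using K(2,3) by (auto simp: order_less_le)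
    moreover have "\<gamma> differentiable (at t)" using K(4)[OF t] by (rule differentiableI_vector)
    ultimately show "norm (\<eta> (\<gamma> t)) = 1 \<and> \<eta> (\<gamma> t) \<bullet> vector_derivative \<gamma> (at t) = 0 \<and>
        (\<forall>\<^sub>F s in at_right 0. \<gamma> t + s *\<^sub>R \<eta> (\<gamma> t) \<notin> closure \<Omega>)"
      using assms(4) unfolding exterior_unit_normal_def by blast
  qed (use assms K in \<open>auto simp: piecewise_C1_boundary_def\<close>)
  then show ?thesis by (rule that)
qed

section \<open>Continuous partial derivatives\<close>

lemma has_derivative_of_continuous_partials:
  fixes u ux uy :: "real \<times> real \<Rightarrow> real"
  assumes \<Omega>: "open \<Omega>" "p \<in> \<Omega>"
    and ux: "\<And>x y. (x, y) \<in> \<Omega> \<Longrightarrow> ((\<lambda>s. u (s, y)) has_real_derivative ux (x, y)) (at x)"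
    and uy: "\<And>x y. (x, y) \<in> \<Omega> \<Longrightarrow> ((\<lambda>s. u (x, s)) has_real_derivative uy (x, y)) (at y)"
    and cont: "continuous_on \<Omega> uy"
  shows "(u has_derivative (\<lambda>q. ux p * fst q + uy p * snd q)) (at p)"
proof -
  obtain x y where p: "p = (x, y)" by (cases p)
  obtain A B where AB: "open A" "open B" "p \<in> A \<times> B" "A \<times> B \<subseteq> \<Omega>"
    using open_prod_elim[OF \<Omega>] by blast
  obtain e where e: "e > 0" "ball y e \<subseteq> B" using AB p openE by blast
  let ?Y = "ball y e"
  have sub: "A \<times> ?Y \<subseteq> \<Omega>" "x \<in> A" "open (A \<times> ?Y)" using AB e p by (auto intro!: open_Times)
  have "((\<lambda>(x, y). u (x, y)) has_derivative
      (\<lambda>(tx, ty). ux (x, y) * tx + blinfun_apply (blinfun_mult_right (uy (x, y))) ty)) (at (x, y) within A \<times> ?Y)"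
  proof (rule has_derivative_partialsI)
    show "((\<lambda>x. u (x, y)) has_derivative (*) (ux (x, y))) (at x within A)"
      using ux[of x y] \<Omega>(2) p by (auto simp: has_field_derivative_def intro: has_derivative_at_withinI)
    show "((\<lambda>y. u (x', y)) has_derivative blinfun_apply (blinfun_mult_right (uy (x', y')))) (at y' within ?Y)"
      if "x' \<in> A" "y' \<in> ?Y" for x' y'
    proof -
      have "(x', y') \<in> \<Omega>" using that sub(1) by blast
      from uy[OF this] show ?thesis
        unfolding has_field_derivative_def blinfun_mult_right.rep_eq by (rule has_derivative_at_withinI)
    qed
    have "continuous_on (A \<times> ?Y) (\<lambda>z. blinfun_mult_right (uy z))"
      by (intro bounded_linear.continuous_on[OF bounded_linear_blinfun_mult_right] continuous_on_subset[OF cont sub(1)])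
    then show "continuous (at (x, y) within A \<times> ?Y) (\<lambda>(x, y). blinfun_mult_right (uy (x, y)))"
      using sub(2) e(1) by (simp add: continuous_on_eq_continuous_within case_prod_beta')
  qed (use e in auto)
  moreover have "at (x, y) within A \<times> ?Y = at (x, y)" using sub e(1) by (intro at_within_open) auto
  ultimately show ?thesis by (simp add: p case_prod_beta' blinfun_mult_right.rep_eq)
qed

text \<open>Schwarz's theorem: by the mean value theorem, the second difference of \<open>u\<close> over a small square is
  the area of the square times a value of either mixed derivative in it.\<close>

lemma mixed_partials_commute:
  fixes u ux uy uxy uyx :: "real \<times> real \<Rightarrow> real"
  assumes \<Omega>: "open \<Omega>" "p \<in> \<Omega>"
    and ux: "\<And>x y. (x, y) \<in> \<Omega> \<Longrightarrow> ((\<lambda>s. u (s, y)) has_real_derivative ux (x, y)) (at x)"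
    and uy: "\<And>x y. (x, y) \<in> \<Omega> \<Longrightarrow> ((\<lambda>s. u (x, s)) has_real_derivative uy (x, y)) (at y)"
    and uxy: "\<And>x y. (x, y) \<in> \<Omega> \<Longrightarrow> ((\<lambda>s. ux (x, s)) has_real_derivative uxy (x, y)) (at y)"
    and uyx: "\<And>x y. (x, y) \<in> \<Omega> \<Longrightarrow> ((\<lambda>s. uy (s, y)) has_real_derivative uyx (x, y)) (at x)"
    and cont: "continuous_on \<Omega> uxy" "continuous_on \<Omega> uyx"
  shows "uxy p = uyx p"
proof (rule ccontr)
  assume ne: "uxy p \<noteq> uyx p"
  define e where "e = \<bar>uxy p - uyx p\<bar> / 2"
  have e: "e > 0" using ne by (simp add: e_def)
  obtain x y where p: "p = (x, y)" by (cases p)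
  obtain d0 where d0: "d0 > 0" "ball p d0 \<subseteq> \<Omega>" using \<Omega> openE by blast
  obtain d1 where d1: "d1 > 0" "\<And>z. z \<in> \<Omega> \<Longrightarrow> dist z p < d1 \<Longrightarrow> dist (uxy z) (uxy p) < e"
    using cont(1) \<Omega>(2) e unfolding continuous_on_iff by metis
  obtain d2 where d2: "d2 > 0" "\<And>z. z \<in> \<Omega> \<Longrightarrow> dist z p < d2 \<Longrightarrow> dist (uyx z) (uyx p) < e"
    using cont(2) \<Omega>(2) e unfolding continuous_on_iff by metis
  define h where "h = min d0 (min d1 d2) / 3"
  have h: "h > 0" "h < d0" "2 * h < d0" "2 * h < d1" "2 * h < d2" using d0 d1 d2 by (auto simp: h_def)
  have near: "dist (a, b) p \<le> 2 * h" if "x \<le> a" "a \<le> x + h" "y \<le> b" "b \<le> y + h" for a b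
    using norm_Pair_le[of "a - x" "b - y"] that by (simp add: dist_norm p)
  have box: "(a, b) \<in> \<Omega>" if "x \<le> a" "a \<le> x + h" "y \<le> b" "b \<le> y + h" for a b
    using near[OF that] h d0(2) by (auto simp: dist_commute subset_iff)
  \<comment> \<open>The four mean values express the same second difference, taken in both orders.\<close>
  let ?\<Delta> = "u (x + h, y + h) - u (x + h, y) - (u (x, y + h) - u (x, y))"
  have "\<exists>z>x. z < x + h \<and> (\<lambda>s. u (s, y + h) - u (s, y)) (x + h) - (\<lambda>s. u (s, y + h) - u (s, y)) x
      = (x + h - x) * (ux (z, y + h) - ux (z, y))"
    by (rule MVT2) (use h box in \<open>auto intro!: DERIV_diff ux\<close>)
  then obtain a where a: "x < a" "a < x + h" "?\<Delta> = h * (ux (a, y + h) - ux (a, y))" by auto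
  have "\<exists>z>y. z < y + h \<and> (\<lambda>s. ux (a, s)) (y + h) - (\<lambda>s. ux (a, s)) y = (y + h - y) * uxy (a, z)"
    by (rule MVT2) (use h a box in \<open>auto intro!: uxy\<close>)
  then obtain b where b: "y < b" "b < y + h" "?\<Delta> = h * (h * uxy (a, b))" using a(3) by auto
  have "\<exists>z>y. z < y + h \<and> (\<lambda>s. u (x + h, s) - u (x, s)) (y + h) - (\<lambda>s. u (x + h, s) - u (x, s)) y
      = (y + h - y) * (uy (x + h, z) - uy (x, z))"
    by (rule MVT2) (use h box in \<open>auto intro!: DERIV_diff uy\<close>)
  then obtain b' where b': "y < b'" "b' < y + h" "?\<Delta> = h * (uy (x + h, b') - uy (x, b'))"
    by (auto simp: algebra_simps)
  have "\<exists>z>x. z < x + h \<and> (\<lambda>s. uy (s, b')) (x + h) - (\<lambda>s. uy (s, b')) x = (x + h - x) * uyx (z, b')"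
    by (rule MVT2) (use h b' box in \<open>auto intro!: uyx\<close>)
  then obtain a' where a': "x < a'" "a' < x + h" "?\<Delta> = h * (h * uyx (a', b'))" using b'(3) by auto
  have eq: "uxy (a, b) = uyx (a', b')" using b(3) a'(3) h(1) by simp
  have "dist (uxy (a, b)) (uxy p) < e" "dist (uyx (a', b')) (uyx p) < e"
    using d1(2)[of "(a, b)"] d2(2)[of "(a', b')"] box[of a b] box[of a' b'] near[of a b] near[of a' b'] h a b a' b' by auto
  then show False using eq by (auto simp: dist_real_def e_def abs_if split: if_splits)
qed

section \<open>The Pohozaev identity for the Tricomi operator\<close>

lemma C1_closure_partials:
  assumes "C1_closure \<Omega> w" "(x, y) \<in> \<Omega>"
  shows "((\<lambda>s. w (s, y)) has_real_derivative partial_x \<Omega> w (x, y)) (at x)"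
    and "((\<lambda>s. w (x, s)) has_real_derivative partial_y \<Omega> w (x, y)) (at y)"
  using assms by (auto simp: C1_closure_def partial_x_def partial_y_def DERIV_deriv_iff_real_differentiable)

text \<open>The divergence of \<open>2 Du (-y\<^sup>m\<^sup>1 u\<^sub>x, -x\<^sup>m\<^sup>2 u\<^sub>y) + E D\<close> with \<open>E = y\<^sup>m\<^sup>1 u\<^sub>x\<^sup>2 + x\<^sup>m\<^sup>2 u\<^sub>y\<^sup>2\<close>. The
  variables \<open>p\<close>, \<open>q\<close>, \<open>pp\<close>, \<open>pq\<close>, \<open>qq\<close> stand for the first and second derivatives of \<open>u\<close>. The
  second derivatives cancel, apart from the product of \<open>Du\<close> with the operator. The weights of \<open>D\<close> are,
  up to sign, those of the anisotropic dilations under which the operator is homogeneous, and therefore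
  both parts of \<open>E\<close> receive the same coefficient.\<close>

lemma pohozaev_algebraic_identity:
  fixes m1 m2 :: nat
  defines "a \<equiv> real m1 + 2" and "b \<equiv> real m2 + 2"
  shows "2 * (- a * p - a * x * pp - b * y * pq) * (- (y ^ m1) * p) + 2 * (- a * x * p - b * y * q) * (- (y ^ m1) * pp)
      + (2 * y ^ m1 * p * pp + (real m2 * x ^ (m2 - 1) * q\<^sup>2 + 2 * x ^ m2 * q * pq)) * (- a * x) + (y ^ m1 * p\<^sup>2 + x ^ m2 * q\<^sup>2) * (- a)
     + (2 * (- a * x * pq - b * q - b * y * qq) * (- (x ^ m2) * q) + 2 * (- a * x * p - b * y * q) * (- (x ^ m2) * qq)
      + ((real m1 * y ^ (m1 - 1) * p\<^sup>2 + 2 * y ^ m1 * p * pq) + 2 * x ^ m2 * q * qq) * (- b * y) + (y ^ m1 * p\<^sup>2 + x ^ m2 * q\<^sup>2) * (- b))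
    = 2 * (- a * x * p - b * y * q) * (- (y ^ m1) * pp - x ^ m2 * qq)
      - (real m1 + real m2 + real m1 * real m2) * (y ^ m1 * p\<^sup>2 + x ^ m2 * (q::real)\<^sup>2)"
proof -
  have 1: "real m2 * x ^ (m2 - 1) * x = real m2 * x ^ m2" "real m1 * y ^ (m1 - 1) * y = real m1 * y ^ m1"
    by (cases m2; simp) (cases m1; simp)
  have "(real m2 * x ^ (m2 - 1) * q\<^sup>2) * (- a * x) = - a * (real m2 * x ^ (m2 - 1) * x) * q\<^sup>2"
    "(real m1 * y ^ (m1 - 1) * p\<^sup>2) * (- b * y) = - b * (real m1 * y ^ (m1 - 1) * y) * p\<^sup>2" by simp_all
  then have 2: "(real m2 * x ^ (m2 - 1) * q\<^sup>2) * (- a * x) = - a * (real m2 * x ^ m2) * q\<^sup>2"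
    "(real m1 * y ^ (m1 - 1) * p\<^sup>2) * (- b * y) = - b * (real m1 * y ^ m1) * p\<^sup>2" unfolding 1 by simp_all
  show ?thesis unfolding distrib_right[of _ _ "- a * x"] distrib_right[of _ _ "- b * y"] 2
    by (simp add: a_def b_def power2_eq_square algebra_simps)
qed

text \<open>A gradient orthogonal to a characteristic direction \<open>(v1, v2)\<close> is a multiple of \<open>(v2, - v1)\<close>, and
  so is the normal; thus both forms are multiples of the characteristic form itself.\<close>

lemma characteristic_forms_vanish:
  fixes v1 v2 n1 n2 p q Y X :: real
  assumes "v2 \<noteq> 0" "Y * v2\<^sup>2 + X * v1\<^sup>2 = 0" "p * v1 + q * v2 = 0" "n1 * v1 + n2 * v2 = 0"
  shows "Y * p\<^sup>2 + X * q\<^sup>2 = 0" and "Y * p * n1 + X * q * n2 = 0"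
proof -
  define \<alpha> \<beta> where "\<alpha> = p / v2" and "\<beta> = n1 / v2"
  have *: "p = \<alpha> * v2" "q = - \<alpha> * v1" "n1 = \<beta> * v2" "n2 = - \<beta> * v1"
    using assms by (simp_all add: \<alpha>_def \<beta>_def field_simps add_eq_0_iff2)
  have "Y * p\<^sup>2 + X * q\<^sup>2 = \<alpha>\<^sup>2 * (Y * v2\<^sup>2 + X * v1\<^sup>2)" "Y * p * n1 + X * q * n2 = \<alpha> * \<beta> * (Y * v2\<^sup>2 + X * v1\<^sup>2)"
    unfolding * by (simp_all add: power2_eq_square algebra_simps)
  then show "Y * p\<^sup>2 + X * q\<^sup>2 = 0" "Y * p * n1 + X * q * n2 = 0" using assms(2) by simp_all
qed

text \<open>The bound \<open>y \<ge> y\<^sub>C\<close> stops the curve half-way: reaching the axis \<open>x = 0\<close> would need a value of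
  \<open>(- y)\<^sup>p\<close> twice the one at \<open>C\<close>.\<close>

lemma tricomi_AC_interior:
  assumes "even (m2 div 2)" "x0 < 0"
    and AC: "(x, y) \<in> tricomi_AC m1 m2 x0" and nA: "(x, y) \<noteq> (2 * x0, 0)"
  shows "y < 0" "x < 0"
proof -
  define k where "k = (m2 + 2) div 2"
  have k: "odd k" using assms(1) by (auto simp: k_def)
  define c d where "c = 2 / (real m1 + 2)" and "d = 2 / (real m2 + 2)"
  have cd: "c > 0" "d > 0" by (auto simp: c_def d_def)
  define N where "N = (2 * x0) ^ k"
  define p where "p = (real m1 + 2) / 2"
  have p: "p > 0" by (simp add: p_def)
  have xy: "x \<le> 0" "tricomi_yC m1 m2 x0 \<le> y" "y \<le> 0" "c * (- y) powr p = d * (x ^ k - N)"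
    using AC by (auto simp: tricomi_AC_def N_def c_def d_def k_def p_def)
  have neg: "N < 0" using k assms(2) unfolding N_def by (subst power_less_zero_eq) auto
  show "y < 0"
  proof (rule ccontr)
    assume "\<not> y < 0"
    then have "y = 0" using xy by simp
    then have "x ^ k = (2 * x0) ^ k" using xy(4) cd p by (simp add: N_def)
    then have "x = 2 * x0" using k by (metis odd_real_root_power_cancel)
    then show False using nA \<open>y = 0\<close> by simp
  qed
  show "x < 0"
  proof (rule ccontr)
    assume "\<not> x < 0"
    then have "x = 0" using xy by simp
    have "k > 0" using k by (auto intro: Nat.gr0I)
    define Z where "Z = - (1 / 2) * ((real m1 + 2) / (real m2 + 2)) * N"
    have Z: "Z > 0" using neg by (simp add: Z_def mult_pos_neg divide_less_0_iff)
    have yC: "tricomi_yC m1 m2 x0 = - (Z powr (1 / p))" by (simp add: tricomi_yC_def Z_def N_def k_def p_def)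
    have "(- y) powr p \<le> (Z powr (1 / p)) powr p"
      using xy(2,3) yC p by (intro powr_mono2) auto
    also have "\<dots> = Z" using Z p by (simp add: powr_powr)
    finally have "c * (- y) powr p \<le> c * Z" using cd by simp
    also have "c * Z = - (d * N) / 2"
      by (simp add: c_def d_def Z_def divide_simps)
    also have "\<dots> < - (d * N)" using neg cd by (simp add: mult_pos_neg)
    also have "\<dots> = c * (- y) powr p" using xy(4) \<open>x = 0\<close> \<open>k > 0\<close> by (simp add: power_0_left)
    finally show False by simp
  qed
qed

text \<open>Differentiating the equation of \<open>AC\<close> gives \<open>(- y) powr (m1 / 2) * y' = - x ^ (m2 / 2) * x'\<close>;
  squaring it gives the characteristic equation.\<close>

lemma tricomi_AC_characteristic:
  fixes \<gamma> :: "real \<Rightarrow> real \<times> real"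
  assumes "odd m1" "even m2"
    and g: "(\<gamma> has_vector_derivative w) (at t)" and y: "snd (\<gamma> t) < 0"
    and AC: "\<forall>\<^sub>F s in nhds t. \<gamma> s \<in> tricomi_AC m1 m2 x0"
  shows "snd (\<gamma> t) ^ m1 * (snd w)\<^sup>2 + fst (\<gamma> t) ^ m2 * (fst w)\<^sup>2 = 0"
proof -
  define k where "k = (m2 + 2) div 2"
  define c d where "c = 2 / (real m1 + 2)" and "d = 2 / (real m2 + 2)"
  define p where "p = (real m1 + 2) / 2"
  define C where "C = - d * (2 * x0) ^ k"
  let ?X = "\<lambda>s. fst (\<gamma> s)" and ?Y = "\<lambda>s. snd (\<gamma> s)"
  have dX: "(?X has_real_derivative fst w) (at t)" and dY: "(?Y has_real_derivative snd w) (at t)"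
    using bounded_linear.has_vector_derivative[OF bounded_linear_fst g]
      bounded_linear.has_vector_derivative[OF bounded_linear_snd g]
    by (auto simp: has_real_derivative_iff_has_vector_derivative)
  have dpow: "((\<lambda>s. (- ?Y s) powr p) has_real_derivative p * (- ?Y t) powr (p - 1) * - snd w) (at t)"
    using y dY by (auto intro!: derivative_eq_intros)
  let ?f = "\<lambda>s. c * (- ?Y s) powr p - d * ?X s ^ k"
  have D: "(?f has_real_derivative (c * (p * (- ?Y t) powr (p - 1) * - snd w) - d * (real k * ?X t ^ (k - 1) * fst w))) (at t)"
    by (rule derivative_eq_intros dpow dX refl | simp)+
  have "\<forall>\<^sub>F s in nhds t. ?f s = C"
    using AC by eventually_elim (auto simp: tricomi_AC_def c_def d_def p_def k_def C_def algebra_simps)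
  then have "(?f has_real_derivative 0) (at t)"
    by (subst DERIV_cong_ev[OF refl _ refl, where g = "\<lambda>_. C"]) auto
  then have eq: "c * (p * (- ?Y t) powr (p - 1) * - snd w) - d * (real k * ?X t ^ (k - 1) * fst w) = 0"
    using DERIV_unique D by blast
  obtain j where j: "m2 = 2 * j" using assms(2) by (auto elim: evenE)
  have cp: "c * p = 1" "d * real k = 1" "k - 1 = j" by (simp_all add: c_def p_def d_def k_def j)
  have "(c * p) * ((- ?Y t) powr (p - 1) * snd w) + (d * real k) * (?X t ^ (k - 1) * fst w) = 0"
    using eq by (simp add: algebra_simps)
  then have "(- ?Y t) powr (p - 1) * snd w = - (?X t ^ j * fst w)" unfolding cp by simp
  then have "((- ?Y t) powr (p - 1) * snd w)\<^sup>2 = (?X t ^ j * fst w)\<^sup>2" by simp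
  moreover have "((- ?Y t) powr (p - 1))\<^sup>2 = (- ?Y t) ^ m1"
  proof -
    have "((- ?Y t) powr (p - 1))\<^sup>2 = (- ?Y t) powr (real m1)"
      using y by (simp add: power2_eq_square powr_add[symmetric] p_def field_simps)
    then show ?thesis using y by (simp add: powr_realpow)
  qed
  moreover have "(?X t ^ j)\<^sup>2 = ?X t ^ m2" by (simp add: j power_mult[symmetric] mult.commute)
  ultimately show ?thesis using \<open>odd m1\<close> by (simp add: power_mult_distrib)
qed

lemma eventually_not_in_tricomi_BC:
  assumes "y < 0" "x \<le> 0" "tricomi_yC m1 m2 x0 \<le> y" "(x, y) \<notin> tricomi_BC m1 m2 x0"
  shows "\<forall>\<^sub>F q in nhds (x, y). q \<notin> tricomi_BC m1 m2 x0"
proof -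
  let ?f = "\<lambda>q. 2 / (real m1 + 2) * (- snd q) powr ((real m1 + 2) / 2) + 2 / (real m2 + 2) * fst q ^ ((m2 + 2) div 2)"
  have "?f (x, y) \<noteq> 0" using assms by (auto simp: tricomi_BC_def)
  moreover have "isCont ?f (x, y)" using assms(1) by (intro continuous_intros) auto
  ultimately have "\<forall>\<^sub>F q in nhds (x, y). ?f q \<noteq> 0"
    unfolding isCont_def tendsto_at_iff_tendsto_nhds[where g = ?f] by (rule tendsto_imp_eventually_ne[rotated])
  then show ?thesis by eventually_elim (auto simp: tricomi_BC_def)
qed

text \<open>In the proof, the fields \<open>(P1, Q1)\<close> and \<open>(P2, Q2)\<close> are those whose normal components are
  \<open>\<omega>\<^sub>1\<close> and \<open>\<omega>\<^sub>2\<close>.\<close>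

theorem theorem1:
  fixes m1 m2 :: nat and x0 :: real
    and \<Omega> \<sigma> :: "(real \<times> real) set"
    and \<gamma> :: "real \<Rightarrow> real \<times> real" and \<eta> :: "real \<times> real \<Rightarrow> real \<times> real"
    and f F :: "real \<Rightarrow> real" and u :: "real \<times> real \<Rightarrow> real"
  assumes "odd m1" and "even m2" and "even (m2 div 2)"
    and "x0 < 0"
    and "tricomi_domain m1 m2 x0 \<Omega> \<sigma>"
    and "piecewise_C1_boundary \<Omega> \<gamma>"
    and "exterior_unit_normal \<Omega> \<gamma> \<eta>"
    and "continuous_on UNIV f"
    and "\<And>s. (F has_real_derivative f s) (at s)" and "F 0 = 0"
    and "C2_closure \<Omega> u"
    and "\<And>p. p \<in> \<Omega> \<Longrightarrow> tricomi_op m1 m2 \<Omega> u p = f (u p)"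
    and "\<And>p. p \<in> tricomi_AC m1 m2 x0 \<union> \<sigma> \<Longrightarrow> u p = 0"
  shows "(real m1 + real m2 + 4) * (LINT p:\<Omega>|lborel. F (u p))
           - (real m1 + real m2 + real m1 * real m2) / 2 * (LINT p:\<Omega>|lborel. u p * f (u p))
         = 1 / 2 * (arclength_integral \<gamma> (tricomi_BC m1 m2 x0 \<union> \<sigma>) (omega1 m1 m2 \<Omega> u \<eta>)
                    + arclength_integral \<gamma> (tricomi_BC m1 m2 x0) (omega2 m1 m2 \<Omega> F u \<eta>))"
proof -
  let ?AC = "tricomi_AC m1 m2 x0" and ?BC = "tricomi_BC m1 m2 x0"
  define v where "v t = vector_derivative \<gamma> (at t)" for t
  have dom: "open \<Omega>" "bounded \<Omega>" "frontier \<Omega> = \<sigma> \<union> ?AC \<union> ?BC"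
    and \<sigma>_pos: "\<sigma> - {(2 * x0, 0), (0, 0)} \<subseteq> {(x, y). y > 0}" and A\<sigma>: "(2 * x0, 0) \<in> \<sigma>"
    using assms(5) unfolding tricomi_domain_def by (metis pathstart_in_path_image)+
  obtain K where "parametrised_boundary \<Omega> \<gamma> v \<eta> K"
    using parametrised_boundary_exists[OF dom(1,2) assms(6,7)] unfolding v_def by blast
  then interpret parametrised_boundary \<Omega> \<gamma> v \<eta> K .
  define p q where "p = partial_x \<Omega> u" and "q = partial_y \<Omega> u"
  define pp pq qp qq where "pp = partial_x \<Omega> p" and "pq = partial_y \<Omega> p"
    and "qp = partial_x \<Omega> q" and "qq = partial_y \<Omega> q"
  have C1: "C1_closure \<Omega> u" "C1_closure \<Omega> p" "C1_closure \<Omega> q"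
    using assms(11) by (auto simp: C2_closure_def p_def q_def)
  have cont [continuous_intros]:
    "continuous_on (closure \<Omega>) u" "continuous_on (closure \<Omega>) p" "continuous_on (closure \<Omega>) q"
    "continuous_on (closure \<Omega>) pp" "continuous_on (closure \<Omega>) pq" "continuous_on (closure \<Omega>) qp" "continuous_on (closure \<Omega>) qq"
    using C1 by (auto simp: C1_closure_def p_def q_def pp_def pq_def qp_def qq_def)
  have ux: "((\<lambda>s. u (s, y)) has_real_derivative p (x, y)) (at x)" and uy: "((\<lambda>s. u (x, s)) has_real_derivative q (x, y)) (at y)"
    and px: "((\<lambda>s. p (s, y)) has_real_derivative pp (x, y)) (at x)" and py: "((\<lambda>s. p (x, s)) has_real_derivative pq (x, y)) (at y)"
    and qx: "((\<lambda>s. q (s, y)) has_real_derivative qp (x, y)) (at x)" and qy: "((\<lambda>s. q (x, s)) has_real_derivative qq (x, y)) (at y)"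
    if "(x, y) \<in> \<Omega>" for x y
    using C1_closure_partials[OF C1(1) that] C1_closure_partials[OF C1(2) that] C1_closure_partials[OF C1(3) that]
    by (auto simp: p_def q_def pp_def pq_def qp_def qq_def)
  have sym: "pq z = qp z" if "z \<in> \<Omega>" for z
    by (rule mixed_partials_commute[OF dom(1) that ux uy py qx])
       (auto intro: continuous_on_subset[OF _ closure_subset] cont)
  have pde: "- (y ^ m1) * pp (x, y) - x ^ m2 * qq (x, y) = f (u (x, y))" if "(x, y) \<in> \<Omega>" for x y
    using assms(12)[OF that] by (simp add: tricomi_op_def pp_def qq_def p_def q_def)
  define a b where "a = real m1 + 2" and "b = real m2 + 2"
  define \<kappa> where "\<kappa> = real m1 + real m2 + real m1 * real m2"
  define Du where "Du z = - a * fst z * p z - b * snd z * q z" for z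
  define E where "E z = snd z ^ m1 * (p z)\<^sup>2 + fst z ^ m2 * (q z)\<^sup>2" for z
  define P1 where "P1 z = 2 * Du z * (- (snd z ^ m1) * p z) + E z * (- a * fst z)" for z
  define Q1 where "Q1 z = 2 * Du z * (- (fst z ^ m2) * q z) + E z * (- b * snd z)" for z
  define P2 where "P2 z = - 2 * F (u z) * (- a * fst z) - \<kappa> * u z * (- (snd z ^ m1) * p z)" for z
  define Q2 where "Q2 z = - 2 * F (u z) * (- b * snd z) - \<kappa> * u z * (- (fst z ^ m2) * q z)" for z
  have om1: "omega1 m1 m2 \<Omega> u \<eta> z = (P1 z, Q1 z) \<bullet> \<eta> z" for z
    by (cases z) (simp add: omega1_def P1_def Q1_def Du_def E_def D_deriv_def tricomi_flux_def D_field_def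
      inner_prod_def p_def[symmetric] q_def[symmetric] a_def b_def)
  have om2: "omega2 m1 m2 \<Omega> F u \<eta> z = (P2 z, Q2 z) \<bullet> \<eta> z" for z
    by (cases z) (simp add: omega2_def P2_def Q2_def tricomi_flux_def D_field_def
      inner_prod_def p_def[symmetric] q_def[symmetric] a_def b_def \<kappa>_def)
  have contF: "continuous_on UNIV F" using assms(9) by (meson DERIV_isCont continuous_at_imp_continuous_on)
  have contFu [continuous_intros]: "continuous_on (closure \<Omega>) (\<lambda>z. F (u z))"
    and contfu [continuous_intros]: "continuous_on (closure \<Omega>) (\<lambda>z. f (u z))"
    by (rule continuous_on_compose2[OF contF cont(1)] continuous_on_compose2[OF assms(8) cont(1)]; simp)+
  define P1x where "P1x z = 2 * (- a * p z - a * fst z * pp z - b * snd z * qp z) * (- (snd z ^ m1) * p z)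
      + 2 * Du z * (- (snd z ^ m1) * pp z)
      + (2 * snd z ^ m1 * p z * pp z + (real m2 * fst z ^ (m2 - 1) * (q z)\<^sup>2 + 2 * fst z ^ m2 * q z * qp z)) * (- a * fst z)
      + E z * (- a)" for z
  define Q1y where "Q1y z = 2 * (- a * fst z * pq z - b * q z - b * snd z * qq z) * (- (fst z ^ m2) * q z)
      + 2 * Du z * (- (fst z ^ m2) * qq z)
      + ((real m1 * snd z ^ (m1 - 1) * (p z)\<^sup>2 + 2 * snd z ^ m1 * p z * pq z) + 2 * fst z ^ m2 * q z * qq z) * (- b * snd z)
      + E z * (- b)" for z
  define P2x where "P2x z = - 2 * (f (u z) * p z) * (- a * fst z) + - 2 * F (u z) * (- a)
      - \<kappa> * (p z * (- (snd z ^ m1) * p z) + u z * (- (snd z ^ m1) * pp z))" for z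
  define Q2y where "Q2y z = - 2 * (f (u z) * q z) * (- b * snd z) + - 2 * F (u z) * (- b)
      - \<kappa> * (q z * (- (fst z ^ m2) * q z) + u z * (- (fst z ^ m2) * qq z))" for z
  have cD: "continuous_on (closure \<Omega>) Du" "continuous_on (closure \<Omega>) E"
    unfolding Du_def[abs_def] E_def[abs_def] by (intro continuous_intros)+
  note [continuous_intros] = cD
  have dE: "((\<lambda>s. E (s, y)) has_real_derivative (2 * y ^ m1 * p (x, y) * pp (x, y)
        + (real m2 * x ^ (m2 - 1) * (q (x, y))\<^sup>2 + 2 * x ^ m2 * q (x, y) * qp (x, y)))) (at x)"
      "((\<lambda>s. E (x, s)) has_real_derivative ((real m1 * y ^ (m1 - 1) * (p (x, y))\<^sup>2 + 2 * y ^ m1 * p (x, y) * pq (x, y))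
        + 2 * x ^ m2 * q (x, y) * qq (x, y))) (at y)"
      "((\<lambda>s. Du (s, y)) has_real_derivative (- a * p (x, y) - a * x * pp (x, y) - b * y * qp (x, y))) (at x)"
      "((\<lambda>s. Du (x, s)) has_real_derivative (- a * x * pq (x, y) - b * q (x, y) - b * y * qq (x, y))) (at y)"
      "((\<lambda>s. F (u (s, y))) has_real_derivative (f (u (x, y)) * p (x, y))) (at x)"
      "((\<lambda>s. F (u (x, s))) has_real_derivative (f (u (x, y)) * q (x, y))) (at y)"
    if z: "(x, y) \<in> \<Omega>" for x y
    unfolding E_def Du_def fst_conv snd_conv
    by (rule DERIV_chain2[OF assms(9)] derivative_eq_intros ux[OF z] uy[OF z] px[OF z] py[OF z] qx[OF z] qy[OF z] refl
        | simp add: algebra_simps)+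
  have cW: "continuous_on (closure \<Omega>) P1" "continuous_on (closure \<Omega>) P1x"
      "continuous_on (closure \<Omega>) Q1" "continuous_on (closure \<Omega>) Q1y"
      "continuous_on (closure \<Omega>) P2" "continuous_on (closure \<Omega>) P2x"
      "continuous_on (closure \<Omega>) Q2" "continuous_on (closure \<Omega>) Q2y"
    unfolding P1_def[abs_def] Q1_def[abs_def] P1x_def[abs_def] Q1y_def[abs_def]
      P2_def[abs_def] Q2_def[abs_def] P2x_def[abs_def] Q2y_def[abs_def]
    by (intro continuous_intros)+
  have div1: "(LINT z:\<Omega>|lborel. P1x z + Q1y z) = (LINT t:{0..1}|lborel. ((P1 (\<gamma> t), Q1 (\<gamma> t)) \<bullet> \<eta> (\<gamma> t)) * norm (v t))"
  proof (rule divergence_theorem)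
    fix x y assume z: "(x, y) \<in> \<Omega>"
    show "((\<lambda>s. P1 (s, y)) has_real_derivative P1x (x, y)) (at x)"
      unfolding P1_def P1x_def fst_conv snd_conv
      by (rule derivative_eq_intros dE[OF z] px[OF z] refl | simp add: algebra_simps)+
    show "((\<lambda>s. Q1 (x, s)) has_real_derivative Q1y (x, y)) (at y)"
      unfolding Q1_def Q1y_def fst_conv snd_conv
      by (rule derivative_eq_intros dE[OF z] qy[OF z] refl | simp add: algebra_simps)+
  qed (rule cW)+
  have div2: "(LINT z:\<Omega>|lborel. P2x z + Q2y z) = (LINT t:{0..1}|lborel. ((P2 (\<gamma> t), Q2 (\<gamma> t)) \<bullet> \<eta> (\<gamma> t)) * norm (v t))"
  proof (rule divergence_theorem)
    fix x y assume z: "(x, y) \<in> \<Omega>"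
    show "((\<lambda>s. P2 (s, y)) has_real_derivative P2x (x, y)) (at x)"
      unfolding P2_def P2x_def fst_conv snd_conv
      by (rule derivative_eq_intros dE[OF z] px[OF z] ux[OF z] refl | simp add: algebra_simps)+
    show "((\<lambda>s. Q2 (x, s)) has_real_derivative Q2y (x, y)) (at y)"
      unfolding Q2_def Q2y_def fst_conv snd_conv
      by (rule derivative_eq_intros dE[OF z] qy[OF z] uy[OF z] refl | simp add: algebra_simps)+
  qed (rule cW)+
  \<comment> \<open>The terms with \<open>Du * f (u)\<close> and with \<open>E\<close> cancel in the sum of the two divergences.\<close>
  have pointwise: "(P1x z + Q1y z) + (P2x z + Q2y z) = 2 * (real m1 + real m2 + 4) * F (u z) - \<kappa> * (u z * f (u z))"
    if zO: "z \<in> \<Omega>" for z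
  proof -
    obtain x y where z: "z = (x, y)" by (cases z)
    have 1: "P1x z + Q1y z = 2 * Du z * f (u z) - \<kappa> * E z"
      unfolding P1x_def Q1y_def Du_def E_def z fst_conv snd_conv a_def b_def \<kappa>_def
      using pohozaev_algebraic_identity[of m1 "p (x,y)" x "pp (x,y)" m2 y "pq (x,y)" "q (x,y)" "qq (x,y)"] pde[of x y]
        sym[OF zO] zO z by simp
    have "P2x z + Q2y z = - 2 * Du z * f (u z) + 2 * (a + b) * F (u z) + \<kappa> * E z
        - \<kappa> * u z * (- (y ^ m1) * pp z - x ^ m2 * qq z)"
      unfolding P2x_def Q2y_def Du_def E_def z fst_conv snd_conv by (simp add: power2_eq_square algebra_simps)
    also have "- (y ^ m1) * pp z - x ^ m2 * qq z = f (u z)" using pde zO z by simp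
    finally show ?thesis using 1 by (simp add: a_def b_def algebra_simps)
  qed
  have interior: "(LINT z:\<Omega>|lborel. P1x z + Q1y z) + (LINT z:\<Omega>|lborel. P2x z + Q2y z)
      = 2 * (real m1 + real m2 + 4) * (LINT z:\<Omega>|lborel. F (u z)) - \<kappa> * (LINT z:\<Omega>|lborel. u z * f (u z))"
  proof -
    have i1: "set_integrable lborel \<Omega> (\<lambda>z. P1x z + Q1y z)" "set_integrable lborel \<Omega> (\<lambda>z. P2x z + Q2y z)"
      by (rule set_integrable_continuous_closure, intro continuous_intros cW)+
    have i2: "set_integrable lborel \<Omega> (\<lambda>z. F (u z))" "set_integrable lborel \<Omega> (\<lambda>z. u z * f (u z))"
      by (rule set_integrable_continuous_closure, intro continuous_intros)+
    have "(LINT z:\<Omega>|lborel. P1x z + Q1y z) + (LINT z:\<Omega>|lborel. P2x z + Q2y z)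
        = (LINT z:\<Omega>|lborel. (P1x z + Q1y z) + (P2x z + Q2y z))"
      by (rule set_integral_add(2)[symmetric, OF i1])
    also have "\<dots> = (LINT z:\<Omega>|lborel. 2 * (real m1 + real m2 + 4) * F (u z) - \<kappa> * (u z * f (u z)))"
      by (rule set_lebesgue_integral_cong) (use dom(1) pointwise in auto)
    also have "\<dots> = (LINT z:\<Omega>|lborel. 2 * (real m1 + real m2 + 4) * F (u z)) - (LINT z:\<Omega>|lborel. \<kappa> * (u z * f (u z)))"
      by (rule set_integral_diff(2)) (use i2 in auto)
    finally show ?thesis by simp
  qed
  \<comment> \<open>The normal at the parameters in \<open>K\<close> is arbitrary, but they form a null set.\<close>
  have restrict: "(LINT t:{0..1}|lborel. ((P (\<gamma> t), Q (\<gamma> t)) \<bullet> \<eta> (\<gamma> t)) * norm (v t))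
      = arclength_integral \<gamma> \<Gamma> (\<lambda>z. (P z, Q z) \<bullet> \<eta> z)"
    if "\<And>t. t \<in> {0..1} - K \<Longrightarrow> \<gamma> t \<notin> \<Gamma> \<Longrightarrow> (P (\<gamma> t), Q (\<gamma> t)) \<bullet> \<eta> (\<gamma> t) = 0" for P Q :: "real \<times> real \<Rightarrow> real" and \<Gamma>
    unfolding arclength_integral_def v_def[symmetric] set_lebesgue_integral_def
    by (rule integral_discrete_difference[where X = K])
       (use finite_K that in \<open>auto simp: indicator_def intro: countable_finite\<close>)
  have curve: "\<gamma> t \<in> \<sigma> \<union> ?AC \<union> ?BC" if "t \<in> {0..1}" for t using \<gamma>_frontier[OF that] dom(3) by simp
  have zero2: "(P2 (\<gamma> t), Q2 (\<gamma> t)) \<bullet> \<eta> (\<gamma> t) = 0" if "t \<in> {0..1} - K" "\<gamma> t \<notin> ?BC" for t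
  proof -
    have "u (\<gamma> t) = 0" using assms(13)[of "\<gamma> t"] curve[of t] that by blast
    then show ?thesis using assms(10) by (simp add: P2_def Q2_def zero_prod_def[symmetric])
  qed
  have grad: "(u has_derivative (\<lambda>h. p z * fst h + q z * snd h)) (at z)" if "z \<in> \<Omega>" for z
    by (rule has_derivative_of_continuous_partials[OF dom(1) that ux uy])
       (auto intro: continuous_on_subset[OF _ closure_subset] cont)
  have zero1: "(P1 (\<gamma> t), Q1 (\<gamma> t)) \<bullet> \<eta> (\<gamma> t) = 0" if t: "t \<in> {0..1} - K" "\<gamma> t \<notin> ?BC \<union> \<sigma>" for t
  proof -
    obtain x y where xy: "\<gamma> t = (x, y)" by (cases "\<gamma> t")
    have AC: "(x, y) \<in> ?AC" using curve[of t] t xy by auto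
    \<comment> \<open>Since \<open>\<gamma> t\<close> is outside \<open>\<sigma>\<close>, it is not the corner \<open>A\<close>, so the curve can be differentiated in the
      equation of \<open>AC\<close>.\<close>
    have "(x, y) \<noteq> (2 * x0, 0)" using A\<sigma> t xy by auto
    then have neg: "y < 0" "x < 0" using tricomi_AC_interior[OF assms(3,4) AC] by auto
    have tG: "t \<in> smooth" using t by (simp add: smooth_def)
    note g = deriv_\<gamma>[OF t(1)]
    have cont_t: "(\<gamma> \<longlongrightarrow> \<gamma> t) (nhds t)"
      using has_vector_derivative_continuous[OF g] by (simp add: isCont_def tendsto_at_iff_tendsto_nhds)
    have nearBC: "\<forall>\<^sub>F s in nhds t. \<gamma> s \<notin> ?BC"
      using eventually_not_in_tricomi_BC[of y x m1 m2 x0] AC neg t(2) xy cont_t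
      by (auto simp: tricomi_AC_def filterlim_iff)
    have "((\<lambda>s. snd (\<gamma> s)) \<longlongrightarrow> y) (nhds t)" using tendsto_snd[OF cont_t] xy by simp
    then have near_neg: "\<forall>\<^sub>F s in nhds t. snd (\<gamma> s) < 0" using neg(1) by (rule order_tendstoD(2))
    have near01: "\<forall>\<^sub>F s in nhds t. s \<in> smooth" using open_smooth tG eventually_nhds by blast
    have nearAC: "\<forall>\<^sub>F s in nhds t. \<gamma> s \<in> ?AC"
      using nearBC near_neg near01
    proof eventually_elim
      case (elim s)
      have "\<gamma> s \<notin> \<sigma>" using \<sigma>_pos elim(2) by (cases "\<gamma> s") force
      then show ?case using curve[of s] elim by (auto simp: smooth_def)
    qed
    have char: "y ^ m1 * (snd (v t))\<^sup>2 + x ^ m2 * (fst (v t))\<^sup>2 = 0"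
      using tricomi_AC_characteristic[OF assms(1,2) g _ nearAC] xy neg by simp
    \<comment> \<open>A horizontal characteristic direction would have to vanish, hence the curve is transversal.\<close>
    have v2: "snd (v t) \<noteq> 0"
    proof
      assume 0: "snd (v t) = 0"
      then have "fst (v t) = 0" using char neg by simp
      then show False using 0 v_nonzero[OF t(1)] by (simp add: prod_eq_iff)
    qed
    have tU: "t \<in> transversal" using tG v2 by (simp add: transversal_def)
    have "\<forall>\<^sub>F s in nhds t. u (\<gamma> s) = 0" using nearAC by eventually_elim (use assms(13) in auto)
    from tangential_derivative_zero[OF tU cont(1,2,3) grad this]
    have tan: "p (\<gamma> t) * fst (v t) + q (\<gamma> t) * snd (v t) = 0" .
    have nor: "fst (\<eta> (\<gamma> t)) * fst (v t) + snd (\<eta> (\<gamma> t)) * snd (v t) = 0"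
      using normal[OF t(1)] by (simp add: inner_prod_def)
    note ch = characteristic_forms_vanish[OF v2 char tan nor]
    have "(P1 (\<gamma> t), Q1 (\<gamma> t)) \<bullet> \<eta> (\<gamma> t) =
       - 2 * Du (\<gamma> t) * (y ^ m1 * p (\<gamma> t) * fst (\<eta> (\<gamma> t)) + x ^ m2 * q (\<gamma> t) * snd (\<eta> (\<gamma> t)))
       + E (\<gamma> t) * (- a * x * fst (\<eta> (\<gamma> t)) - b * y * snd (\<eta> (\<gamma> t)))"
      by (simp add: P1_def Q1_def inner_prod_def xy algebra_simps)
    moreover have "E (\<gamma> t) = 0" using ch(1) by (simp add: E_def xy)
    ultimately show ?thesis using ch(2) by simp
  qed
  have "2 * (real m1 + real m2 + 4) * (LINT z:\<Omega>|lborel. F (u z)) - \<kappa> * (LINT z:\<Omega>|lborel. u z * f (u z))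
    = arclength_integral \<gamma> (?BC \<union> \<sigma>) (omega1 m1 m2 \<Omega> u \<eta>) + arclength_integral \<gamma> ?BC (omega2 m1 m2 \<Omega> F u \<eta>)"
    using interior div1 div2 restrict[of "?BC \<union> \<sigma>" P1 Q1, OF zero1] restrict[of ?BC P2 Q2, OF zero2]
    unfolding om1[abs_def] om2[abs_def] by simp
  then show ?thesis by (simp add: \<kappa>_def field_simps)
qed

end
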